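(* Let $n\ge3$, let $q$ be a prime power and $\mathbb{V}_0=\mathbb{F}_q^n$. Let $\mathcal{T}$ be the set of all twin classes of $\mathbf{SIG}(\mathbb{V}_0)$ in the part $\mathcal{E}^{n-1}(\mathbb{F}_q)$. Consider the map $$\Phi:Aut(\mathbf{SIG}(\mathbb{V}_0))\longrightarrow PGL_n(\mathbb{F}_q)\rtimes Aut(\mathbb{F}_q),\qquad \Phi(\varphi)=\varphi|_{\mathbb{P}^{n-1}(\mathbb{F}_q)}.$$ Then $\Phi$ is a group epimorphism, and $\ker(\Phi)\cong\prod_{\mathcal{C}\in\mathcal{T}}S_{\mathcal{C}}$ is the direct product of the permutation groups on the twin classes in the part $\mathcal{E}^{n-1}(\mathbb{F}_q)$.
   Context: $\mathbb{F}_q$ is the finite field with $q$ elements and $\mathbb{V}_0=\mathbb{F}_q^n$ is the space of column vectors. $E_n(\mathbb{F}_q)$ is the set of nonzero matrices $M\in M_n(\mathbb{F}_q)$ having at least one eigenvector in $\mathbb{V}_0$ (a nonzero $v$ with $Mv=\lambda v$ for some $\lambda\in\mathbb{F}_q$; $\lambda=0$ allowed). $\mathcal{E}^{n-1}(\mathbb{F}_q)=\{\langle M\rangle: M\in E_n(\mathbb{F}_q)\}$ is the set of one-dimensional subspaces of $M_n(\mathbb{F}_q)$ generated by elements of $E_n(\mathbb{F}_q)$, and $\mathbb{P}^{n-1}(\mathbb{F}_q)$ is the set of one-dimensional subspaces $\langle v\rangle$ of $\mathbb{V}_0$. The spectral incidence graph $\mathbf{SIG}(\mathbb{V}_0)$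 is the simple bipartite graph with vertex set the disjoint union $\mathcal{E}^{n-1}(\mathbb{F}_q)\cup\mathbb{P}^{n-1}(\mathbb{F}_q)$ in which $\langle M\rangle$ and $\langle v\rangle$ are adjacent iff $v$ is an eigenvector of $M$. $N(x)$ is the set of neighbours of $x$; two vertices $x,y$ are twins if $N(x)=N(y)$, and the twin classes are the equivalence classes of this relation. $Aut$ of a graph is its group of graph automorphisms (permutations of the whole vertex set preserving adjacency in both directions). $S_{\mathcal{C}}$ is the symmetric group on $\mathcal{C}$; an element of $\prod_{\mathcal{C}\in\mathcal{T}}S_{\mathcal{C}}$ acts on the vertex set by permuting each $\mathcal{C}\in\mathcal{T}$ by its component and fixing every vertex of $\mathbb{P}^{n-1}(\mathbb{F}_q)$. $PGL_n(\mathbb{F}_q)=GL_n(\mathbb{F}_q)/\{\lambda I_n:\lambda\ne0\}$. For a field automorphism $\sigma\in Aut(\mathbb{F}_q)$, $v^\sigma$ and $B^\sigma$ denote entrywise application of $\sigma$. Elements of $PGL_n(\mathbb{F}_q)\rtimes Aut(\mathbb{F}_q)$ are pairs $[A,\sigma]$ with product $[A,\sigma][B,\tau]=[AB^\sigma,\sigma\tau]$; this group is identified with the group of permutations $\langle v\rangle\mapsto\langle Av^\sigma\rangle$ of $\mathbb{P}^{n-1}(\mathbb{F}_q)$, and in this sense $\varphi|_{\mathbb{P}^{n-1}(\mathbb{F}_q)}$ is regarded as an element of it (that the restriction does lie in this group is part of $\Phi$ being well defined). *)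

theory Defs
  imports "HOL-Analysis.Cartesian_Space" "HOL-Algebra.Bij" "HOL-Algebra.Product_Groups"
    "Graph_Theory.Pair_Digraph"
begin

section \<open>Simple graphs: automorphisms and twins\<close>

text \<open>
  A simple graph is a \<^typ>\<open>'v pair_pre_digraph\<close> satisfying \<^locale>\<open>pair_graph\<close>: every edge is
  present as two opposite arcs.
\<close>

definition neighbours :: "'v pair_pre_digraph \<Rightarrow> 'v \<Rightarrow> 'v set" where
  "neighbours G x = {y. (x, y) \<in> parcs G}"

definition twin_rel :: "'v pair_pre_digraph \<Rightarrow> 'v rel" where
  "twin_rel G = {(x, y). x \<in> pverts G \<and> y \<in> pverts G \<and> neighbours G x = neighbours G y}"

definition twin_classes :: "'v pair_pre_digraph \<Rightarrow> 'v set set" where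
  "twin_classes G = pverts G // twin_rel G"

text \<open>Permutations are represented, as in \<^const>\<open>Bij\<close>, by functions that are \<^term>\<open>undefined\<close>
  outside the vertex set.\<close>

definition aut_group :: "'v pair_pre_digraph \<Rightarrow> ('v \<Rightarrow> 'v) monoid" where
  "aut_group G = (BijGroup (pverts G))
     \<lparr>carrier := {f \<in> Bij (pverts G).
        \<forall>x \<in> pverts G. \<forall>y \<in> pverts G. (f x, f y) \<in> parcs G \<longleftrightarrow> (x, y) \<in> parcs G}\<rparr>"


section \<open>The spectral incidence graph\<close>

definition mat_scale :: "'a::times \<Rightarrow> 'a^'n^'m \<Rightarrow> 'a^'n^'m" where
  "mat_scale c M = (\<chi> i j. c * M $ i $ j)"

interpretation mats: vector_space "mat_scale :: 'a::field \<Rightarrow> 'a^'n^'m \<Rightarrow> 'a^'n^'m"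
  by unfold_locales (simp_all add: mat_scale_def vec_eq_iff algebra_simps)

definition eigenvector :: "'a::field^'n^'n \<Rightarrow> 'a^'n \<Rightarrow> bool" where
  "eigenvector M v \<longleftrightarrow> v \<noteq> 0 \<and> (\<exists>c. M *v v = c *s v)"

definition eigen_matrices :: "('a::field^'n^'n) set" where
  "eigen_matrices = {M. M \<noteq> 0 \<and> (\<exists>v. eigenvector M v)}"

definition matrix_points :: "('a::field^'n^'n) set set" where
  "matrix_points = {mats.span {M} | M. M \<in> eigen_matrices}"

definition proj_points :: "('a::field^'n) set set" where
  "proj_points = {vec.span {v} | v. v \<noteq> 0}"

type_synonym ('a, 'n) sig_vertex = "('a^'n^'n) set + ('a^'n) set"

definition sig_edges :: "(('a::field, 'n::finite) sig_vertex) rel" where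
  "sig_edges = {(Inl (mats.span {M}), Inr (vec.span {v})) | M v.
     M \<in> eigen_matrices \<and> eigenvector M v}"

definition SIG :: "(('a::field, 'n::finite) sig_vertex) pair_pre_digraph" where
  "SIG = \<lparr>pverts = Inl ` matrix_points \<union> Inr ` proj_points, parcs = sig_edges \<union> sig_edges\<inverse>\<rparr>"

lemma pair_graph_SIG: "pair_graph (SIG :: ('a::{field,finite}, 'n::finite) sig_vertex pair_pre_digraph)"
proof
  show "finite (pverts (SIG :: ('a, 'n) sig_vertex pair_pre_digraph))"
    by simp
  show "finite (parcs (SIG :: ('a, 'n) sig_vertex pair_pre_digraph))"
    by simp
  show "symmetric (with_proj (SIG :: ('a, 'n) sig_vertex pair_pre_digraph))"
    by (auto simp: symmetric_def SIG_def sym_def)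
qed (auto simp: SIG_def sig_edges_def matrix_points_def proj_points_def eigenvector_def)

definition matrix_twin_classes :: "(('a::field, 'n::finite) sig_vertex) set set" where
  "matrix_twin_classes = {C \<in> twin_classes SIG. C \<subseteq> Inl ` matrix_points}"

text \<open>The action on vertices of a family \<open>f\<close> of permutations, one for each twin class of matrix
  vertices.\<close>

definition twin_action ::
  "(('a::field, 'n::finite) sig_vertex set \<Rightarrow> ('a, 'n) sig_vertex \<Rightarrow> ('a, 'n) sig_vertex)
    \<Rightarrow> ('a, 'n) sig_vertex \<Rightarrow> ('a, 'n) sig_vertex" where
  "twin_action f = (\<lambda>x \<in> pverts SIG.
     case x of Inl m \<Rightarrow> f (twin_rel SIG `` {x}) x | Inr p \<Rightarrow> x)"


section \<open>The group \<open>PGL\<^sub>n(\<F>\<^sub>q) \<rtimes> Aut(\<F>\<^sub>q)\<close>\<close>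

definition field_aut_group :: "('a::field \<Rightarrow> 'a) monoid" where
  "field_aut_group = \<lparr>carrier = {\<sigma>. bij \<sigma> \<and> (\<forall>x y. \<sigma> (x + y) = \<sigma> x + \<sigma> y) \<and>
     (\<forall>x y. \<sigma> (x * y) = \<sigma> x * \<sigma> y)}, monoid.mult = (\<circ>), one = id\<rparr>"

definition GL :: "('a::field^'n^'n) monoid" where
  "GL = \<lparr>carrier = {A. invertible A}, monoid.mult = (**), one = mat 1\<rparr>"

definition PGL :: "('a::field^'n^'n) set monoid" where
  "PGL = GL Mod {mat c | c. c \<noteq> 0}"

definition semidirect :: "('g, 'x) monoid_scheme \<Rightarrow> ('h, 'y) monoid_scheme \<Rightarrow> ('h \<Rightarrow> 'g \<Rightarrow> 'g)
    \<Rightarrow> ('g \<times> 'h) monoid" where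
  "semidirect G H act = \<lparr>carrier = carrier G \<times> carrier H,
     monoid.mult = (\<lambda>(a, s) (b, t). (a \<otimes>\<^bsub>G\<^esub> act s b, s \<otimes>\<^bsub>H\<^esub> t)),
     one = (\<one>\<^bsub>G\<^esub>, \<one>\<^bsub>H\<^esub>)\<rparr>"

text \<open>Elements of \<^const>\<open>PGL\<close> are cosets, on which a field automorphism acts by taking the image.\<close>

definition PGammaL :: "(('a::field^'n^'n) set \<times> ('a \<Rightarrow> 'a)) monoid" where
  "PGammaL = semidirect PGL field_aut_group (\<lambda>\<sigma> X. map_matrix \<sigma> ` X)"

text \<open>\<open>\<phi>\<close> restricts on the projective points to the permutation
  \<open>\<langle>v\<rangle> \<mapsto> \<langle>A v\<^sup>\<sigma>\<rangle>\<close> identified with the pair \<open>g = [A, \<sigma>]\<close>. Quantifying over all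
  representatives \<open>A\<close> of the (nonempty) coset \<^term>\<open>fst g\<close> is harmless, since they differ by
  nonzero scalars.\<close>

definition restricts_to :: "(('a::field, 'n::finite) sig_vertex \<Rightarrow> ('a, 'n) sig_vertex)
    \<Rightarrow> ('a^'n^'n) set \<times> ('a \<Rightarrow> 'a) \<Rightarrow> bool" where
  "restricts_to \<phi> g \<longleftrightarrow> (\<forall>A \<in> fst g. \<forall>v. v \<noteq> 0 \<longrightarrow>
     \<phi> (Inr (vec.span {v})) = Inr (vec.span {A *v (\<chi> i. snd g (v $ i))}))"

definition Phi :: "(('a::field, 'n::finite) sig_vertex \<Rightarrow> ('a, 'n) sig_vertex)
    \<Rightarrow> ('a^'n^'n) set \<times> ('a \<Rightarrow> 'a)" where
  "Phi \<phi> = (THE g. g \<in> carrier PGammaL \<and> restricts_to \<phi> g)"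

end

theory Submission
  imports Defs
begin

text \<open>
  The identity matrix is adjacent to every point while no point is adjacent to every matrix, so an
  automorphism \<open>\<phi>\<close> permutes the points. The main step recovers collinearity from the sets of
  eigenvectors: a point \<open>r\<close> lies off the line through two points \<open>p\<close> and \<open>q\<close> exactly if some matrix
  has the eigenvectors \<open>p\<close>, \<open>q\<close> and at least a third one but not \<open>r\<close>, and another matrix has the
  same eigenvectors and \<open>r\<close> in addition. Off the line such matrices are
  \<open>p f\<^sup>T\<close> and \<open>r f\<^sup>T\<close> for a functional \<open>f\<close> that vanishes at \<open>p\<close> and \<open>q\<close> but not at \<open>r\<close>
  (\<open>eigenvector_adjoined_off_line\<close>), and on the line they cannot exist
  (\<open>no_eigenvector_adjoined_on_line\<close>). So \<open>\<phi>\<close> acts on the points by a collineation, and the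
  fundamental theorem of projective geometry (\<open>preserves_lines_semilinear\<close>) provides \<open>A\<close> and \<open>\<sigma>\<close>
  with \<open>\<phi>\<langle>v\<rangle> = \<langle>A v\<^sup>\<sigma>\<rangle>\<close>. They are unique up to scaling \<open>A\<close> (\<open>semilinear_unique\<close>), which makes \<open>\<Phi>\<close>
  well defined and multiplicative.

  For surjectivity, the semilinear map \<open>v \<mapsto> A v\<^sup>\<sigma>\<close> extends to the matrix vertices by the conjugation
  \<open>M \<mapsto> A M\<^sup>\<sigma> A\<^sup>-\<^sup>1\<close>. An automorphism is in the kernel if and only if it fixes all points; then it
  preserves the neighbourhood of each matrix vertex, that is, each twin class. Conversely, permuting
  the matrix vertices inside their twin classes changes no adjacency (\<open>twin_action_iso\<close>).
\<close>

section \<open>Points, lines and eigenvectors\<close>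

lemma span_singleton_iff: "u \<in> vec.span {v} \<longleftrightarrow> (\<exists>c. u = c *s v)"
  by (auto simp: vec.span_singleton)

lemma span_pair_iff: "u \<in> vec.span {v, w} \<longleftrightarrow> (\<exists>a b. u = a *s v + b *s w)"
  by (auto simp: vec.span_insert[of v "{w}"] span_singleton_iff algebra_simps)

lemma span_singleton_eq_iff:
  assumes "v \<noteq> 0"
  shows "vec.span {v} = vec.span {w} \<longleftrightarrow> w \<noteq> 0 \<and> v \<in> vec.span {w}"
proof
  assume eq: "vec.span {v} = vec.span {w}"
  then show "w \<noteq> 0 \<and> v \<in> vec.span {w}"
    using assms vec.span_base[of v "{v}"] by auto
next
  assume r: "w \<noteq> 0 \<and> v \<in> vec.span {w}"
  then obtain c where c: "v = c *s w" by (auto simp: span_singleton_iff)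
  with assms have "c \<noteq> 0" by auto
  with c have "w = inverse c *s v" by simp
  then have "w \<in> vec.span {v}" by (metis span_singleton_iff)
  with r show "vec.span {v} = vec.span {w}" by (simp add: vec.span_eq)
qed

lemma span_scale_eq: "c \<noteq> 0 \<Longrightarrow> vec.span {c *s v} = vec.span {v}"
  by (cases "v = 0") (auto simp: span_singleton_eq_iff span_singleton_iff)

lemma scale_mem_span_iff: "c \<noteq> 0 \<Longrightarrow> c *s v \<in> vec.span S \<longleftrightarrow> v \<in> vec.span S"
  using vec.span_scale[of "c *s v" S "inverse c"] vec.span_scale[of v S c] by auto

lemma mats_span_singleton_iff: "N \<in> mats.span {M} \<longleftrightarrow> (\<exists>c. N = mat_scale c M)"
  by (auto simp: mats.span_singleton)

lemma mats_span_singleton_eqD: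
  assumes "mats.span {M} = mats.span {N}" and "M \<noteq> 0"
  obtains c where "c \<noteq> 0" and "M = mat_scale c N"
proof -
  have "M \<in> mats.span {N}" using mats.span_base[of M "{M}"] assms(1) by simp
  then obtain c where "M = mat_scale c N" by (auto simp: mats_span_singleton_iff)
  moreover with assms(2) have "c \<noteq> 0" by auto
  ultimately show thesis using that by blast
qed

lemma mat_scale_vector_mult: "mat_scale c M *v v = c *s (M *v v)"
  by (simp add: vec_eq_iff mat_scale_def matrix_vector_mult_def sum_distrib_left algebra_simps)

lemma eigenvector_scale: "c \<noteq> 0 \<Longrightarrow> eigenvector M (c *s v) \<longleftrightarrow> eigenvector M v"
  unfolding eigenvector_def
  by (simp add: vec.scale algebra_simps vector_smult_assoc)
     (metis mult.commute mult_cancel_left vec.scale_left_imp_eq vec.scale_scale vec.scale_cancel_left)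

lemma eigenvector_span_cong:
  assumes "vec.span {v} = vec.span {w}"
  shows "eigenvector M v \<longleftrightarrow> eigenvector M w"
proof (cases "v = 0")
  case True
  then have "w = 0" using assms vec.span_base[of w "{w}"] by auto
  with True show ?thesis by simp
next
  case False
  then obtain c where "v = c *s w" "c \<noteq> 0"
    using assms by (auto simp: span_singleton_eq_iff span_singleton_iff)
  then show ?thesis by (simp add: eigenvector_scale)
qed

lemma eigenvector_mat_scale: "c \<noteq> 0 \<Longrightarrow> eigenvector (mat_scale c M) v \<longleftrightarrow> eigenvector M v"
  unfolding eigenvector_def mat_scale_vector_mult
  by (metis (no_types, opaque_lifting) left_inverse vec.scale_one vec.scale_scale)

lemma eigenvector_mats_span_cong:
  assumes "mats.span {M} = mats.span {N}" and "M \<noteq> 0"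
  shows "eigenvector M v \<longleftrightarrow> eigenvector N v"
  using assms by (elim mats_span_singleton_eqD) (simp_all add: eigenvector_mat_scale)

lemma eigenvalues_eq_of_sum:
  assumes p: "M *v p = a *s p" and q: "M *v q = b *s q" and "p \<noteq> 0" and nq: "q \<notin> vec.span {p}"
    and "eigenvector M (p + q)"
  shows "a = b"
proof -
  obtain c where "M *v (p + q) = c *s (p + q)" using assms(5) by (auto simp: eigenvector_def)
  then have e: "(b - c) *s q = (c - a) *s p"
    by (simp add: matrix_vector_right_distrib p q algebra_simps)
  have bc: "b = c"
  proof (rule ccontr)
    assume "b \<noteq> c"
    then have "q = inverse (b - c) *s ((b - c) *s q)" by simp
    also have "\<dots> = (inverse (b - c) * (c - a)) *s p" unfolding e by simp
    finally show False using nq by (auto simp: span_singleton_iff)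
  qed
  with e \<open>p \<noteq> 0\<close> show "a = b" by auto
qed

text \<open>Three eigenvectors on a line belong to the same eigenvalue. So if \<open>p + q\<close> can be adjoined to
  the eigenvectors of \<open>M\<close>, all points of the line are eigenvectors of \<open>M'\<close> and all but one of
  \<open>M\<close>, although \<open>p\<close> and \<open>q\<close> belong to different eigenvalues of \<open>M\<close>; this leaves
  only lines with three points. The further eigenvector \<open>s\<close> turns out to belong to a third eigenvalue of
  \<open>M\<close>, so the field has more than two elements and the line more than three points. Without \<open>s\<close> the conclusion
  fails over the field with two elements.\<close>

lemma no_eigenvector_adjoined_on_line:
  fixes M M' :: "'a::field^'n^'n"
  assumes "p \<noteq> 0" and q: "q \<notin> vec.span {p}"
    and Mp: "eigenvector M p" and Mq: "eigenvector M q" and Mpq: "\<not> eigenvector M (p + q)"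
    and Ms: "eigenvector M s" and sp: "s \<notin> vec.span {p}" and sq: "s \<notin> vec.span {q}"
    and M': "\<And>v. v \<noteq> 0 \<Longrightarrow> eigenvector M' v \<longleftrightarrow> eigenvector M v \<or> v \<in> vec.span {p + q}"
  shows False
proof -
  have s0: "s \<noteq> 0" using Ms by (simp add: eigenvector_def)
  have q0: "q \<noteq> 0" using Mq by (simp add: eigenvector_def)
  obtain \<alpha> \<beta> \<gamma> where ev: "M *v p = \<alpha> *s p" "M *v q = \<beta> *s q" "M *v s = \<gamma> *s s"
    using Mp Mq Ms by (auto simp: eigenvector_def)
  have pq0: "p + q \<noteq> 0"
    using q vec.span_neg[OF vec.span_base[of p "{p}"]] by (metis add_eq_0_iff singletonI)
  have ab: "\<alpha> \<noteq> \<beta>"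
    using Mpq pq0 ev by (auto simp: eigenvector_def matrix_vector_right_distrib vec.scale_right_distrib)
  have no: "\<not> eigenvector M (x *s p + y *s q)" if "x \<noteq> 0" "y \<noteq> 0" for x y
  proof
    assume "eigenvector M (x *s p + y *s q)"
    then have "\<alpha> = \<beta>"
      using that \<open>p \<noteq> 0\<close> q ev
      by (intro eigenvalues_eq_of_sum[of M "x *s p" _ "y *s q"])
         (auto simp: vec.scale mult.commute span_scale_eq scale_mem_span_iff)
    with ab show False by simp
  qed
  have spq: "s \<notin> vec.span {p, q}"
  proof
    assume "s \<in> vec.span {p, q}"
    then obtain x y where s: "s = x *s p + y *s q" by (auto simp: span_pair_iff)
    show False
    proof (cases "x = 0 \<or> y = 0")
      case True
      then show False using s sp sq by (auto simp: span_singleton_iff)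
    next
      case False
      then show False using no Ms s by auto
    qed
  qed
  have M'I: "eigenvector M' v" if "eigenvector M v" for v
    using that M'[of v] by (auto simp: eigenvector_def)
  obtain l where l: "M' *v p = l *s p" using M'I[OF Mp] by (auto simp: eigenvector_def)
  obtain l' where l': "M' *v q = l' *s q" using M'I[OF Mq] by (auto simp: eigenvector_def)
  obtain d where d: "M' *v s = d *s s" using M'I[OF Ms] by (auto simp: eigenvector_def)
  have "eigenvector M' (p + q)" using M'[OF pq0] vec.span_base by auto
  then have ll: "l' = l" using eigenvalues_eq_of_sum[OF l l' \<open>p \<noteq> 0\<close> q] by simp
  \<comment> \<open>Otherwise \<open>M'\<close> is scalar on the plane through \<open>p\<close>, \<open>q\<close>, \<open>s\<close>, and \<open>p + q + s\<close> is an eigenvector of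
    \<open>M\<close> with nonzero components in three eigenvectors of \<open>M\<close>.\<close>
  have dl: "d \<noteq> l"
  proof
    assume "d = l"
    let ?v = "(p + q) + s"
    have nv: "?v \<notin> vec.span {p + q}"
    proof
      assume "?v \<in> vec.span {p + q}"
      then obtain c where "(p + q) + s = c *s (p + q)" by (auto simp: span_singleton_iff)
      then have "s = (c - 1) *s p + (c - 1) *s q" by (simp add: algebra_simps)
      with spq show False by (auto simp: span_pair_iff)
    qed
    have v0: "?v \<noteq> 0" using nv by (metis vec.span_zero)
    have "eigenvector M' ?v"
      using v0 l l' d ll \<open>d = l\<close> by (auto simp: eigenvector_def matrix_vector_right_distrib vec.scale_right_distrib)
    with M'[OF v0] nv have "eigenvector M ?v" by simp
    then obtain c where "M *v ?v = c *s ?v" by (auto simp: eigenvector_def)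
    then have e: "(\<gamma> - c) *s s = (c - \<alpha>) *s p + (c - \<beta>) *s q"
      by (simp add: matrix_vector_right_distrib ev algebra_simps)
    have gc: "\<gamma> = c"
    proof (rule ccontr)
      assume "\<gamma> \<noteq> c"
      then have "s = inverse (\<gamma> - c) *s ((\<gamma> - c) *s s)" by simp
      also have "\<dots> = (inverse (\<gamma> - c) * (c - \<alpha>)) *s p + (inverse (\<gamma> - c) * (c - \<beta>)) *s q"
        unfolding e by (simp add: vec.scale_right_distrib)
      finally show False using spq by (auto simp: span_pair_iff)
    qed
    have "M *v (p + q) = c *s (p + q)"
      using e gc by (simp add: matrix_vector_right_distrib ev algebra_simps)
    with pq0 Mpq show False by (auto simp: eigenvector_def)
  qed
  have ag: "\<alpha> \<noteq> \<gamma>"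
  proof
    assume "\<alpha> = \<gamma>"
    moreover have "p + s \<noteq> 0"
      using sp vec.span_neg[OF vec.span_base[of p "{p}"]] by (metis add_eq_0_iff singletonI)
    ultimately have "eigenvector M (p + s)"
      using ev by (auto simp: eigenvector_def matrix_vector_right_distrib vec.scale_right_distrib)
    from eigenvalues_eq_of_sum[OF l d \<open>p \<noteq> 0\<close> sp M'I[OF this]] dl show False by simp
  qed
  have bg: "\<beta> \<noteq> \<gamma>"
  proof
    assume "\<beta> = \<gamma>"
    moreover have "q + s \<noteq> 0"
      using sq vec.span_neg[OF vec.span_base[of q "{q}"]] by (metis add_eq_0_iff singletonI)
    ultimately have "eigenvector M (q + s)"
      using ev by (auto simp: eigenvector_def matrix_vector_right_distrib vec.scale_right_distrib)
    from eigenvalues_eq_of_sum[OF l' d q0 sq M'I[OF this]] dl ll show False by simp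
  qed
  \<comment> \<open>Three distinct scalars yield a point of the line other than \<open>p\<close>, \<open>q\<close> and \<open>p + q\<close>.\<close>
  define c where "c = (\<gamma> - \<alpha>) / (\<beta> - \<alpha>)"
  have c: "c \<noteq> 0" "c \<noteq> 1" using ab ag bg by (auto simp: c_def)
  let ?v = "1 *s p + c *s q"
  have nv: "?v \<notin> vec.span {p + q}"
  proof
    assume "?v \<in> vec.span {p + q}"
    then obtain x where "1 *s p + c *s q = x *s (p + q)" by (auto simp: span_singleton_iff)
    then have e: "(c - x) *s q = (x - 1) *s p" by (simp add: algebra_simps)
    have "c = x"
    proof (rule ccontr)
      assume "c \<noteq> x"
      then have "q = inverse (c - x) *s ((c - x) *s q)" by simp
      also have "\<dots> = (inverse (c - x) * (x - 1)) *s p" unfolding e by simp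
      finally show False using q by (auto simp: span_singleton_iff)
    qed
    with e c \<open>p \<noteq> 0\<close> show False by auto
  qed
  have v0: "?v \<noteq> 0" using nv by (metis vec.span_zero)
  have "eigenvector M' ?v"
    using v0 l l' ll by (auto simp: eigenvector_def matrix_vector_right_distrib vec.scale_right_distrib vec.scale mult.commute intro!: exI[of _ l])
  with M'[OF v0] nv have "eigenvector M ?v" by simp
  with no[of 1 c] c show False by simp
qed

definition outer_product :: "'a::times^'m \<Rightarrow> 'a^'n \<Rightarrow> 'a^'n^'m" where
  "outer_product u f = (\<chi> i j. u $ i * f $ j)"

lemma outer_product_vector_mult:
  "outer_product u f *v v = (\<Sum>j\<in>UNIV. f $ j * v $ j) *s (u :: 'a::field^'m)"
  by (simp add: vec_eq_iff outer_product_def matrix_vector_mult_def sum_distrib_right sum_distrib_left algebra_simps)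

lemma eigenvector_outer_product:
  fixes u f :: "'a::field^'n"
  assumes "u \<noteq> 0" and "v \<noteq> 0"
  shows "eigenvector (outer_product u f) v \<longleftrightarrow> (\<Sum>j\<in>UNIV. f $ j * v $ j) = 0 \<or> v \<in> vec.span {u}"
    (is "_ \<longleftrightarrow> ?f v = 0 \<or> _")
proof
  assume "eigenvector (outer_product u f) v"
  then obtain c where c: "?f v *s u = c *s v" by (auto simp: eigenvector_def outer_product_vector_mult)
  show "?f v = 0 \<or> v \<in> vec.span {u}"
  proof (cases "c = 0")
    case True
    then show ?thesis using c \<open>u \<noteq> 0\<close> by simp
  next
    case False
    then have "v = inverse c *s (c *s v)" by simp
    also have "\<dots> = (inverse c * ?f v) *s u" unfolding c[symmetric] by simp
    finally show ?thesis by (auto simp: span_singleton_iff)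
  qed
next
  assume r: "?f v = 0 \<or> v \<in> vec.span {u}"
  show "eigenvector (outer_product u f) v"
  proof (cases "?f v = 0")
    case True
    then show ?thesis using \<open>v \<noteq> 0\<close> by (auto simp: eigenvector_def outer_product_vector_mult intro!: exI[of _ 0])
  next
    case False
    then obtain a where a: "v = a *s u" using r by (auto simp: span_singleton_iff)
    then have "a \<noteq> 0" using \<open>v \<noteq> 0\<close> by auto
    then have "?f v *s u = (?f v * inverse a) *s v" using a by simp
    then show ?thesis using \<open>v \<noteq> 0\<close> unfolding eigenvector_def outer_product_vector_mult by blast
  qed
qed

lemma separating_functional:
  fixes r :: "'a::field^'n"
  assumes "r \<notin> vec.span S"
  obtains f :: "'a^'n" where "\<And>v. v \<in> S \<Longrightarrow> (\<Sum>j\<in>UNIV. f $ j * v $ j) = 0" and "(\<Sum>j\<in>UNIV. f $ j * r $ j) = 1"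
proof -
  obtain B where B: "B \<subseteq> S" "vec.independent B" "S \<subseteq> vec.span B"
    using vec.maximal_independent_subset[of S] by blast
  have rB: "r \<notin> vec.span B" using assms vec.span_mono[OF B(1)] by auto
  then have ind: "vec.independent (insert r B)" using B(2) by (simp add: vec.independent_insertI)
  fix k :: 'n
  obtain g :: "'a^'n \<Rightarrow> 'a^'n" where g: "Vector_Spaces.linear (*s) (*s) g"
    and gr: "\<forall>x\<in>insert r B. g x = (if x = r then axis k 1 else 0)"
    using vec.linear_independent_extend[OF ind, of "\<lambda>x. if x = r then axis k 1 else 0"] by blast
  have gB: "g b = 0" if "b \<in> B" for b using gr that rB vec.span_base by force
  have gS: "g v = 0" if "v \<in> vec.span B" for v
    using vec.linear_eq_0_on_span[OF g] gB that by blast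
  define f where "f = matrix g $ k"
  have f: "(\<Sum>j\<in>UNIV. f $ j * v $ j) = g v $ k" for v
    using matrix_works[OF g, of v] by (simp add: f_def matrix_vector_mult_def vec_eq_iff)
  show thesis
  proof (rule that[of f])
    show "(\<Sum>j\<in>UNIV. f $ j * v $ j) = 0" if "v \<in> S" for v using gS that B(3) f by auto
    show "(\<Sum>j\<in>UNIV. f $ j * r $ j) = 1" using gr f by (simp add: axis_def)
  qed
qed

text \<open>The witnesses are rank-one matrices with a common kernel, a hyperplane through \<open>p\<close> and \<open>q\<close>
  that misses \<open>r\<close>: one with image \<open>\<langle>p\<rangle>\<close>, hence nilpotent, and one with image \<open>\<langle>r\<rangle>\<close>. The
  image only matters where it leaves the kernel.\<close>

lemma eigenvector_adjoined_off_line: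
  fixes p q r :: "'a::field^'n"
  assumes "p \<noteq> 0" and q: "q \<notin> vec.span {p}" and r: "r \<notin> vec.span {p, q}"
  obtains M M' s where "M \<in> eigen_matrices" and "M' \<in> eigen_matrices"
    and "eigenvector M p" and "eigenvector M q" and "\<not> eigenvector M r"
    and "eigenvector M s" and "s \<notin> vec.span {p}" and "s \<notin> vec.span {q}"
    and "\<And>v. v \<noteq> 0 \<Longrightarrow> eigenvector M' v \<longleftrightarrow> eigenvector M v \<or> v \<in> vec.span {r}"
proof -
  obtain f :: "'a^'n" where f: "\<And>v. v \<in> {p, q} \<Longrightarrow> (\<Sum>j\<in>UNIV. f $ j * v $ j) = 0"
    and fr: "(\<Sum>j\<in>UNIV. f $ j * r $ j) = 1"
    using separating_functional[OF r] by blast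
  have r0: "r \<noteq> 0" using r by (metis vec.span_zero)
  have q0: "q \<noteq> 0" using q by (metis vec.span_zero)
  have f0: "(\<Sum>j\<in>UNIV. f $ j * v $ j) = 0" if vp: "v \<in> vec.span {p}" for v
  proof -
    obtain c where "v = c *s p" using vp by (auto simp: span_singleton_iff)
    then have "(\<Sum>j\<in>UNIV. f $ j * v $ j) = c * (\<Sum>j\<in>UNIV. f $ j * p $ j)"
      by (simp add: sum_distrib_left algebra_simps)
    then show ?thesis using f by simp
  qed
  have E: "eigenvector (outer_product p f) v \<longleftrightarrow> (\<Sum>j\<in>UNIV. f $ j * v $ j) = 0" if "v \<noteq> 0" for v
    using that \<open>p \<noteq> 0\<close> by (auto simp: eigenvector_outer_product f0)
  have E': "eigenvector (outer_product r f) v \<longleftrightarrow> eigenvector (outer_product p f) v \<or> v \<in> vec.span {r}" if "v \<noteq> 0" for v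
    using that r0 by (auto simp: eigenvector_outer_product E)
  have Mp: "eigenvector (outer_product p f) p" using E \<open>p \<noteq> 0\<close> f by auto
  have pq0: "p + q \<noteq> 0"
    using q vec.span_neg[OF vec.span_base[of p "{p}"]] by (metis add_eq_0_iff singletonI)
  have nz: "outer_product u f \<noteq> 0" if "u \<noteq> 0" for u
  proof
    assume "outer_product u f = 0"
    then have "outer_product u f *v r = 0" by simp
    with that fr show False by (simp add: outer_product_vector_mult)
  qed
  show thesis
  proof (rule that[of "outer_product p f" "outer_product r f" "p + q"])
    show "outer_product p f \<in> eigen_matrices" "outer_product r f \<in> eigen_matrices"
      using nz Mp E' \<open>p \<noteq> 0\<close> r0 by (auto simp: eigen_matrices_def)
    show "eigenvector (outer_product p f) q" using E q0 f by auto
    show "\<not> eigenvector (outer_product p f) r" using E r0 fr by simp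
    show "eigenvector (outer_product p f) (p + q)"
      using E[OF pq0] f by (simp add: ring_distribs sum.distrib)
    show "p + q \<notin> vec.span {p}"
      using q vec.span_add_eq[of p "{p}" q] vec.span_base by auto
    show "p + q \<notin> vec.span {q}"
    proof
      assume "p + q \<in> vec.span {q}"
      then have "p \<in> vec.span {q}" using vec.span_add_eq2[of q "{q}" p] vec.span_base by auto
      then show False
        using q \<open>p \<noteq> 0\<close> q0 span_singleton_eq_iff[of p q] vec.span_base[of q "{q}"] by auto
    qed
  qed (use Mp E' in auto)
qed

section \<open>Collineations are semilinear\<close>

definition field_automorphism :: "('a::field \<Rightarrow> 'a) \<Rightarrow> bool" where
  "field_automorphism \<sigma> \<longleftrightarrow> bij \<sigma> \<and> (\<forall>x y. \<sigma> (x + y) = \<sigma> x + \<sigma> y) \<and> (\<forall>x y. \<sigma> (x * y) = \<sigma> x * \<sigma> y)"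

abbreviation map_vec :: "('a \<Rightarrow> 'a) \<Rightarrow> 'a^'n \<Rightarrow> 'a^'n" where
  "map_vec \<sigma> v \<equiv> (\<chi> i. \<sigma> (v $ i))"

text \<open>A map on projective points is represented by a choice of vectors spanning the images.\<close>

definition preserves_lines :: "('a::field^'n \<Rightarrow> 'a^'n) \<Rightarrow> bool" where
  "preserves_lines h \<longleftrightarrow> (\<forall>v. v \<noteq> 0 \<longrightarrow> h v \<noteq> 0) \<and>
    (\<forall>u v w. u \<noteq> 0 \<longrightarrow> v \<noteq> 0 \<longrightarrow> w \<noteq> 0 \<longrightarrow> u \<in> vec.span {v, w} \<longrightarrow> h u \<in> vec.span {h v, h w})"

lemma preserves_lines_nonzero: "preserves_lines h \<Longrightarrow> v \<noteq> 0 \<Longrightarrow> h v \<noteq> 0"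
  by (simp add: preserves_lines_def)

lemma preserves_lines_pair:
  "preserves_lines h \<Longrightarrow> u \<noteq> 0 \<Longrightarrow> v \<noteq> 0 \<Longrightarrow> w \<noteq> 0 \<Longrightarrow> u \<in> vec.span {v, w} \<Longrightarrow> h u \<in> vec.span {h v, h w}"
  by (simp add: preserves_lines_def)

lemma preserves_lines_single:
  "preserves_lines h \<Longrightarrow> u \<noteq> 0 \<Longrightarrow> v \<noteq> 0 \<Longrightarrow> u \<in> vec.span {v} \<Longrightarrow> h u \<in> vec.span {h v}"
  using preserves_lines_pair[of h u v v] by simp

lemma preserves_lines_span:
  assumes h: "preserves_lines h" and "finite S" and "0 \<notin> S" and "u \<noteq> 0" and "u \<in> vec.span S"
  shows "h u \<in> vec.span (h ` S)"
  using assms(2-)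
proof (induction S arbitrary: u rule: finite_induct)
  case empty
  then show ?case by simp
next
  case (insert a S)
  then obtain k where k: "u - k *s a \<in> vec.span S" by (auto simp: vec.span_breakdown_eq)
  show ?case
  proof (cases "u - k *s a = 0")
    case True
    then have "u \<in> vec.span {a}" by (auto simp: span_singleton_iff)
    then have "h u \<in> vec.span {h a}" using preserves_lines_single[OF h] insert.prems by auto
    then show ?thesis using vec.span_mono[of "{h a}" "h ` insert a S"] by auto
  next
    case False
    let ?s = "u - k *s a"
    have hs: "h ?s \<in> vec.span (h ` S)" using insert.IH[of ?s] insert.prems False k by auto
    have "u = k *s a + 1 *s ?s" by simp
    then have "u \<in> vec.span {a, ?s}" unfolding span_pair_iff by blast
    then have "h u \<in> vec.span {h a, h ?s}"
      using preserves_lines_pair[OF h] insert.prems False by auto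
    moreover have "vec.span {h a, h ?s} \<subseteq> vec.span (h ` insert a S)"
      using hs vec.span_mono[of "h ` S" "h ` insert a S"]
      by (intro vec.span_minimal) (auto intro: vec.span_base)
    ultimately show ?thesis by auto
  qed
qed

lemma preserves_lines_subspace:
  assumes h: "preserves_lines h" and "finite S" and "0 \<notin> S" and "u \<noteq> 0" and "u \<in> vec.span S"
    and "vec.subspace T" and "\<And>v. v \<in> S \<Longrightarrow> h v \<in> T"
  shows "h u \<in> T"
  using preserves_lines_span[OF assms(1-5)] vec.span_minimal[of "h ` S" T] assms(6-7) by auto

lemma preserves_lines_matrix:
  assumes h: "preserves_lines h" and C: "invertible (C :: 'a::field^'n^'n)"
  shows "preserves_lines (\<lambda>v. C *v h v)"
  unfolding preserves_lines_def
proof (intro conjI allI impI)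
  fix v :: "'a^'n" assume "v \<noteq> 0"
  then have "h v \<noteq> 0" using h by (rule preserves_lines_nonzero[rotated])
  then show "C *v h v \<noteq> 0" using inj_matrix_vector_mult[OF C] by (metis injD matrix_vector_mult_0_right)
next
  fix u v w :: "'a^'n" assume "u \<noteq> 0" "v \<noteq> 0" "w \<noteq> 0" "u \<in> vec.span {v, w}"
  then have "h u \<in> vec.span {h v, h w}" by (rule preserves_lines_pair[OF h])
  then show "C *v h u \<in> vec.span {C *v h v, C *v h w}"
    unfolding span_pair_iff by (metis matrix_vector_right_distrib vec.scale)
qed

lemma axis_eq_0 [simp]: "axis i (1 :: 'a::field) \<noteq> 0"
  by (simp add: axis_eq_0_iff)

lemma axis_nth_if: "axis i c $ j = (if j = i then c else (0::'a::zero))"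
  by (auto simp: axis_def)

lemma matrix_vector_mult_axis: "A *v axis k 1 = column k (A :: 'a::field^'n^'m)"
proof -
  have "(\<Sum>j\<in>UNIV. A $ i $ j * (if j = k then 1 else 0)) = A $ i $ k" for i
    by (subst sum.remove[of _ k]) auto
  then show ?thesis by (simp add: matrix_vector_mult_def axis_nth_if column_def vec_eq_iff)
qed

lemma mem_span_axes:
  fixes v :: "'a::field^'n"
  assumes "\<And>i. i \<notin> I \<Longrightarrow> v $ i = 0"
  shows "v \<in> vec.span ((\<lambda>i. axis i 1) ` I)"
proof -
  have "v = (\<Sum>i\<in>UNIV. v $ i *s axis i 1)"
    by (simp add: basis_expansion)
  also have "\<dots> \<in> vec.span ((\<lambda>i. axis i 1) ` I)"
  proof (rule vec.span_sum)
    fix i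
    show "v $ i *s axis i 1 \<in> vec.span ((\<lambda>i. axis i 1) ` I)"
      using assms[of i] by (cases "i \<in> I") (auto intro: vec.span_scale vec.span_base vec.span_zero)
  qed
  finally show ?thesis .
qed

lemma subspace_nth: "vec.subspace {y :: 'a::field^'n. y $ i = c * y $ j}"
  by (auto simp: vec.subspace_def algebra_simps)

text \<open>The spans of all but one of the axes are the coordinate hyperplanes; being spans, they are
  preserved.\<close>

lemma preserves_lines_nth_0:
  fixes h :: "'a::field^'n \<Rightarrow> 'a^'n"
  assumes h: "preserves_lines h" and ax: "\<And>i. h (axis i 1) \<in> vec.span {axis i 1}"
    and "v \<noteq> 0" and "v $ j = 0"
  shows "h v $ j = 0"
proof -
  have "h v \<in> {y. y $ j = 0 * y $ j}"
  proof (rule preserves_lines_subspace[OF h])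
    show "v \<in> vec.span ((\<lambda>i. axis i 1) ` (- {j}))" by (rule mem_span_axes) (use assms in auto)
    show "h u \<in> {y. y $ j = 0 * y $ j}" if u: "u \<in> (\<lambda>i. axis i 1) ` (- {j})" for u
    proof -
      obtain i where "i \<noteq> j" "u = axis i 1" using u by auto
      with ax[of i] show ?thesis by (auto simp: span_singleton_iff axis_nth_if)
    qed
    show "vec.subspace {y :: 'a^'n. y $ j = 0 * y $ j}" by (rule subspace_nth)
  qed (use assms in auto)
  then show ?thesis by simp
qed

lemma preserves_lines_nth_nonzero:
  fixes h :: "'a::field^'n \<Rightarrow> 'a^'n"
  assumes h: "preserves_lines h" and ax: "\<And>i. h (axis i 1) \<in> vec.span {axis i 1}"
    and v: "v $ j \<noteq> 0"
  shows "h v $ j \<noteq> 0"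
proof
  assume 0: "h v $ j = 0"
  let ?S = "insert v ((\<lambda>i. axis i 1) ` (- {j}))"
  have "axis j 1 - inverse (v $ j) *s v \<in> vec.span ((\<lambda>i. axis i 1) ` (- {j}))"
    by (rule mem_span_axes) (use v in \<open>auto simp: axis_nth_if\<close>)
  then have sp: "axis j 1 \<in> vec.span ?S" by (auto simp: vec.span_breakdown_eq)
  have "h (axis j 1) \<in> {y. y $ j = 0 * y $ j}"
  proof (rule preserves_lines_subspace[OF h _ _ _ sp])
    show "0 \<notin> ?S" using v by auto
    show "h u \<in> {y. y $ j = 0 * y $ j}" if u: "u \<in> ?S" for u
    proof (cases "u = v")
      case False
      then obtain i where "i \<noteq> j" "u = axis i 1" using u by auto
      with ax[of i] show ?thesis by (auto simp: span_singleton_iff axis_nth_if)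
    qed (use 0 in auto)
    show "vec.subspace {y :: 'a^'n. y $ j = 0 * y $ j}" by (rule subspace_nth)
  qed auto
  moreover have "h (axis j 1) \<noteq> 0" using preserves_lines_nonzero[OF h] by simp
  ultimately show False using ax[of j] by (auto simp: span_singleton_iff axis_nth_if)
qed

text \<open>In the affine chart \<open>v\<^sub>o = 1\<close> the map acts on each coordinate separately, because
  the affine hyperplane \<open>v\<^sub>i = c\<close> corresponds to the span of \<open>e\<^sub>o + c e\<^sub>i\<close> and the remaining axes.
  The points at infinity of the chart, where \<open>v\<^sub>o = 0\<close>, see these
  coordinate maps only up to a common factor; comparing them makes the coordinate maps equal,
  multiplicative and additive.\<close>

lemma preserves_lines_normalised:
  fixes h :: "'a::{field,finite}^'n \<Rightarrow> 'a^'n"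
  assumes n: "CARD('n) \<ge> 3" and h: "preserves_lines h"
    and ax: "\<And>i. h (axis i 1) \<in> vec.span {axis i 1}"
    and ax2: "\<And>i. i \<noteq> o' \<Longrightarrow> h (axis o' 1 + axis i 1) \<in> vec.span {axis o' 1 + axis i 1}"
  obtains \<sigma> where "field_automorphism \<sigma>" and "\<And>v. v \<noteq> 0 \<Longrightarrow> h v \<in> vec.span {map_vec \<sigma> v}"
proof -
  note zero = preserves_lines_nth_0[OF h ax]
  note nonzero = preserves_lines_nth_nonzero[OF h ax]
  define \<tau> where "\<tau> i c = (let y = h (axis o' 1 + c *s axis i 1) in y $ i / y $ o')" for i c
  \<comment> \<open>\<open>v\<close> lies in the span of \<open>e\<^sub>o + c e\<^sub>i\<close> and the axes other than \<open>e\<^sub>o\<close> and \<open>e\<^sub>i\<close>.\<close>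
  have affine: "h v $ i = \<tau> i c * h v $ o'" if v: "v $ o' \<noteq> 0" "v $ i = c * v $ o'" and i: "i \<noteq> o'" for v i c
  proof -
    let ?b = "axis o' 1 + c *s axis i 1"
    let ?S = "insert ?b ((\<lambda>i. axis i 1) ` (- {o', i}))"
    have b: "?b $ o' \<noteq> 0" "?b \<noteq> 0" using i by (auto simp: axis_nth_if vec_eq_iff)
    have "v - (v $ o') *s ?b \<in> vec.span ((\<lambda>i. axis i 1) ` (- {o', i}))"
      by (rule mem_span_axes) (use v i in \<open>auto simp: axis_nth_if\<close>)
    then have sp: "v \<in> vec.span ?S" unfolding vec.span_breakdown_eq by blast
    have "h v \<in> {y. y $ i = \<tau> i c * y $ o'}"
    proof (rule preserves_lines_subspace[OF h _ _ _ sp subspace_nth])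
      show "h u \<in> {y. y $ i = \<tau> i c * y $ o'}" if u: "u \<in> ?S" for u
      proof (cases "u = ?b")
        case True
        then show ?thesis using nonzero[OF b(1)] by (simp add: \<tau>_def Let_def)
      next
        case False
        then obtain j where "j \<noteq> o'" "j \<noteq> i" "u = axis j 1" using u by auto
        with ax[of j] show ?thesis by (auto simp: span_singleton_iff axis_nth_if)
      qed
    qed (use v b in auto)
    then show ?thesis by simp
  qed
  \<comment> \<open>The points \<open>e\<^sub>o\<close> and \<open>e\<^sub>o + v\<close> of the chart lie on a line with \<open>v\<close>.\<close>
  have infinite: "\<exists>a. a \<noteq> 0 \<and> (\<forall>i. i \<noteq> o' \<longrightarrow> h v $ i = a * \<tau> i (v $ i))" if v: "v \<noteq> 0" "v $ o' = 0" for v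
  proof -
    let ?w = "axis o' 1 + v"
    have w: "?w $ o' \<noteq> 0" using v by (simp add: axis_nth_if)
    then have w0: "?w \<noteq> 0" by (metis zero_index)
    have "v = 1 *s ?w + (-1) *s axis o' 1" by simp
    then have "v \<in> vec.span {?w, axis o' 1}" unfolding span_pair_iff by blast
    then have "h v \<in> vec.span {h ?w, h (axis o' 1)}" using preserves_lines_pair[OF h] v w0 by auto
    then obtain a b where ab: "h v = a *s h ?w + b *s h (axis o' 1)" by (auto simp: span_pair_iff)
    have eq: "h v $ i = (a * h ?w $ o') * \<tau> i (v $ i)" if i: "i \<noteq> o'" for i
    proof -
      have "h (axis o' 1) $ i = 0" using zero[of "axis o' 1" i] i by (simp add: axis_nth_if)
      moreover have "h ?w $ i = \<tau> i (v $ i) * h ?w $ o'"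
        by (rule affine) (use i v w in \<open>auto simp: axis_nth_if\<close>)
      ultimately show ?thesis by (simp add: ab)
    qed
    moreover have "a * h ?w $ o' \<noteq> 0"
    proof
      assume "a * h ?w $ o' = 0"
      then have "h v $ i = 0" for i using eq[of i] zero[OF v] by (cases "i = o'") auto
      then have "h v = 0" by (simp add: vec_eq_iff)
      then show False using preserves_lines_nonzero[OF h v(1)] by simp
    qed
    ultimately show ?thesis by blast
  qed
  have \<tau>0: "\<tau> i 0 = 0" if "i \<noteq> o'" for i
  proof -
    have "h (axis o' 1) $ i = 0" using zero[of "axis o' 1" i] that by (simp add: axis_nth_if)
    then show ?thesis by (simp add: \<tau>_def)
  qed
  have \<tau>1: "\<tau> i 1 = 1" if i: "i \<noteq> o'" for i
  proof -
    let ?b = "axis o' 1 + axis i (1::'a)"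
    obtain c where c: "h ?b = c *s ?b" using ax2[OF i] by (auto simp: span_singleton_iff)
    have "h ?b $ o' \<noteq> 0" using nonzero[of ?b o'] i by (simp add: axis_nth_if)
    then have "c \<noteq> 0" using c by auto
    then show ?thesis using i by (simp add: \<tau>_def c axis_nth_if)
  qed
  obtain i j where ij: "i \<noteq> o'" "j \<noteq> o'" "i \<noteq> j"
  proof -
    have "card (UNIV - {o'}) \<ge> 2" using n by (simp add: card_Diff_singleton)
    then obtain T where "T \<subseteq> UNIV - {o'}" "card T = 2" by (meson obtain_subset_with_card_n)
    then show thesis using that by (auto simp: card_2_iff)
  qed
  \<comment> \<open>Compare the images of \<open>e\<^sub>k + e\<^sub>l\<close> and its multiple by \<open>c\<close>, which are the same point.\<close>
  have same: "\<tau> k c = \<tau> l c" if kl: "k \<noteq> o'" "l \<noteq> o'" for k l c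
  proof (cases "k = l \<or> c = 0")
    case True
    then show ?thesis using \<tau>0 kl by auto
  next
    case False
    let ?u = "axis k 1 + axis l (1::'a)"
    have u: "?u $ o' = 0" "?u $ k = 1" "?u $ l = 1" using False kl by (auto simp: axis_nth_if)
    then have u0: "?u \<noteq> 0" "c *s ?u \<noteq> 0" "(c *s ?u) $ o' = 0"
      using False by (auto dest: arg_cong[of _ _ "\<lambda>x. x $ k"])
    obtain a where a: "a \<noteq> 0" "h ?u $ k = a" "h ?u $ l = a"
      using infinite[OF u0(1) u(1)] u \<tau>1 kl by auto
    obtain b where b: "b \<noteq> 0" "h (c *s ?u) $ k = b * \<tau> k c" "h (c *s ?u) $ l = b * \<tau> l c"
      using infinite[OF u0(2,3)] u kl by auto
    have "h (c *s ?u) \<in> vec.span {h ?u}"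
      using preserves_lines_single[OF h u0(2,1)] by (simp add: scale_mem_span_iff vec.span_base vec.span_scale)
    then obtain d where "h (c *s ?u) = d *s h ?u" by (auto simp: span_singleton_iff)
    then have "b * \<tau> k c = b * \<tau> l c" using a b by (metis vector_smult_component)
    then show ?thesis using b by simp
  qed
  define \<sigma> where "\<sigma> = \<tau> i"
  have \<tau>\<sigma>: "\<tau> k = \<sigma>" if "k \<noteq> o'" for k using same[OF that ij(1)] by (auto simp: \<sigma>_def)
  have \<sigma>0: "\<sigma> 0 = 0" and \<sigma>1: "\<sigma> 1 = 1" using \<tau>0 \<tau>1 ij by (auto simp: \<sigma>_def)
  \<comment> \<open>Compare the images of \<open>e\<^sub>i + d e\<^sub>j\<close> and its multiple by \<open>c\<close>.\<close>
  have mult: "\<sigma> (c * d) = \<sigma> c * \<sigma> d" for c d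
  proof (cases "c = 0")
    case True
    then show ?thesis by (simp add: \<sigma>0)
  next
    case False
    let ?u = "axis i 1 + d *s axis j (1::'a)"
    have u: "?u $ o' = 0" "?u $ i = 1" "?u $ j = d" using ij by (auto simp: axis_nth_if)
    then have u0: "?u \<noteq> 0" "c *s ?u \<noteq> 0" "(c *s ?u) $ o' = 0"
      using False by (auto dest: arg_cong[of _ _ "\<lambda>x. x $ i"])
    obtain a where a: "a \<noteq> 0" "h ?u $ i = a" "h ?u $ j = a * \<sigma> d"
      using infinite[OF u0(1) u(1)] u \<sigma>1 \<tau>\<sigma> ij by auto
    obtain b where b: "b \<noteq> 0" "h (c *s ?u) $ i = b * \<sigma> c" "h (c *s ?u) $ j = b * \<sigma> (c * d)"
      using infinite[OF u0(2,3)] u \<tau>\<sigma> ij by auto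
    have "h (c *s ?u) \<in> vec.span {h ?u}"
      using preserves_lines_single[OF h u0(2,1)] by (simp add: scale_mem_span_iff vec.span_base vec.span_scale)
    then obtain e where e: "h (c *s ?u) = e *s h ?u" by (auto simp: span_singleton_iff)
    have "b * \<sigma> (c * d) = (b * \<sigma> c) * \<sigma> d"
      using a b e by (metis vector_smult_component mult.assoc)
    then show ?thesis using b by simp
  qed
  \<comment> \<open>The point at infinity of the line through two points of the chart is their difference; the
    coordinate \<open>j\<close> fixes the common factor.\<close>
  have diff: "\<sigma> (x - y) = \<sigma> x - \<sigma> y" for x y
  proof -
    let ?v = "axis o' 1 + x *s axis i 1 + axis j (1::'a)" and ?w = "axis o' 1 + y *s axis i (1::'a)"
    let ?u = "(x - y) *s axis i 1 + axis j (1::'a)"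
    have v: "?v $ o' = 1" "?v $ i = x" "?v $ j = 1" and w: "?w $ o' = 1" "?w $ i = y" "?w $ j = 0"
      and u: "?u $ o' = 0" "?u $ i = x - y" "?u $ j = 1" using ij by (auto simp: axis_nth_if)
    then have nz: "?u \<noteq> 0" "?v \<noteq> 0" "?w \<noteq> 0"
      by (metis zero_index zero_neq_one)+
    have "?u = 1 *s ?v + (-1) *s ?w" by (simp add: algebra_simps)
    then have "?u \<in> vec.span {?v, ?w}" unfolding span_pair_iff by blast
    then have "h ?u \<in> vec.span {h ?v, h ?w}" using preserves_lines_pair[OF h] nz by blast
    then obtain a b where ab: "h ?u = a *s h ?v + b *s h ?w" by (auto simp: span_pair_iff)
    obtain e where e: "e \<noteq> 0" "h ?u $ i = e * \<sigma> (x - y)" "h ?u $ j = e"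
      using infinite[OF nz(1) u(1)] u \<sigma>1 \<tau>\<sigma> ij by auto
    have "h ?v $ i = \<tau> i x * h ?v $ o'" "h ?v $ j = \<tau> j 1 * h ?v $ o'"
      by (rule affine; simp only: v ij mult_1_right; simp)+
    then have hv: "h ?v $ i = \<sigma> x * h ?v $ o'" "h ?v $ j = h ?v $ o'"
      by (simp_all only: \<tau>\<sigma> ij \<sigma>1 mult_1_left not_False_eq_True)
    have "h ?w $ i = \<tau> i y * h ?w $ o'" "h ?w $ j = \<tau> j 0 * h ?w $ o'"
      by (rule affine; simp only: w ij mult_1_right mult_zero_left; simp)+
    then have hw: "h ?w $ i = \<sigma> y * h ?w $ o'" "h ?w $ j = 0"
      by (simp_all only: \<tau>\<sigma> ij \<sigma>0 mult_zero_left not_False_eq_True)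
    have 1: "a * h ?v $ o' + b * h ?w $ o' = 0"
      using arg_cong[OF ab, of "\<lambda>y. y $ o'"] zero[OF nz(1) u(1)] by simp
    have 2: "e = a * h ?v $ o'"
      using arg_cong[OF ab, of "\<lambda>y. y $ j"] hv hw e by simp
    have 3: "b * h ?w $ o' = - e" using 1 2 by (simp add: eq_neg_iff_add_eq_0 add.commute)
    have "e * \<sigma> (x - y) = a * (\<sigma> x * h ?v $ o') + b * (\<sigma> y * h ?w $ o')"
      using arg_cong[OF ab, of "\<lambda>y. y $ i"] hv hw e by simp
    also have "\<dots> = \<sigma> x * (a * h ?v $ o') + \<sigma> y * (b * h ?w $ o')" by (simp add: algebra_simps)
    also have "\<dots> = e * (\<sigma> x - \<sigma> y)" unfolding 3 2[symmetric] by (simp add: algebra_simps)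
    finally show ?thesis using e by simp
  qed
  have add: "\<sigma> (x + y) = \<sigma> x + \<sigma> y" for x y
    using diff[of x "- y"] diff[of 0 y] \<sigma>0 by simp
  have "inj \<sigma>"
  proof (rule injI)
    fix x y assume "\<sigma> x = \<sigma> y"
    then have "\<sigma> (x - y) * \<sigma> (inverse (x - y)) = 0" by (simp add: diff)
    then show "x = y" using mult[of "x - y" "inverse (x - y)"] \<sigma>1 by (cases "x = y") auto
  qed
  then have "bij \<sigma>" by (simp add: bij_def finite_UNIV_inj_surj)
  then have aut: "field_automorphism \<sigma>" using add mult by (auto simp: field_automorphism_def)
  have "h v \<in> vec.span {map_vec \<sigma> v}" if v: "v \<noteq> 0" for v
  proof (cases "v $ o' = 0")
    case True
    then obtain a where "\<forall>i. i \<noteq> o' \<longrightarrow> h v $ i = a * \<sigma> (v $ i)" using infinite[OF v] \<tau>\<sigma> by auto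
    moreover have "h v $ o' = a * \<sigma> (v $ o')" using zero[OF v] True \<sigma>0 by simp
    ultimately have "h v = a *s map_vec \<sigma> v" by (auto simp: vec_eq_iff)
    then show ?thesis by (auto simp: span_singleton_iff)
  next
    case False
    define a where "a = h v $ o' * \<sigma> (inverse (v $ o'))"
    have "h v $ k = a * \<sigma> (v $ k)" for k
    proof (cases "k = o'")
      case True
      then show ?thesis using mult[of "inverse (v $ o')" "v $ o'"] False \<sigma>1
        by (simp add: a_def algebra_simps)
    next
      case k: False
      have "h v $ k = \<sigma> (v $ k * inverse (v $ o')) * h v $ o'"
        using affine[of v k "v $ k * inverse (v $ o')"] False k \<tau>\<sigma> by simp
      then show ?thesis by (simp add: a_def mult algebra_simps)
    qed
    then have "h v = a *s map_vec \<sigma> v" by (simp add: vec_eq_iff)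
    then show ?thesis unfolding span_singleton_iff by blast
  qed
  with aut that show thesis by blast
qed

text \<open>The fundamental theorem of projective geometry. A linear change of coordinates moves the images
  of the axes back to the axes, and a diagonal one those of the \<open>e\<^sub>o + e\<^sub>i\<close>.\<close>

theorem preserves_lines_semilinear:
  fixes h :: "'a::{field,finite}^'n \<Rightarrow> 'a^'n"
  assumes n: "CARD('n) \<ge> 3" and h: "preserves_lines h"
    and onto: "\<And>w. w \<noteq> 0 \<Longrightarrow> \<exists>v. v \<noteq> 0 \<and> w \<in> vec.span {h v}"
  obtains A \<sigma> where "invertible A" and "field_automorphism \<sigma>"
    and "\<And>v. v \<noteq> 0 \<Longrightarrow> vec.span {h v} = vec.span {A *v map_vec \<sigma> v}"
proof -
  define B :: "'a^'n^'n" where "B = (\<chi> i j. h (axis j 1) $ i)"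
  have Bax: "B *v axis j 1 = h (axis j 1)" for j
    by (simp add: B_def matrix_vector_mult_axis column_def vec_eq_iff)
  have "\<exists>x. w = B *v x" for w
  proof (cases "w = 0")
    case True
    then show ?thesis by (metis matrix_vector_mult_0_right)
  next
    case False
    then obtain v where v: "v \<noteq> 0" "w \<in> vec.span {h v}" using onto by blast
    let ?S = "(\<lambda>i. axis i (1::'a)) ` (UNIV :: 'n set)"
    have sp: "v \<in> vec.span ?S" by (rule mem_span_axes) simp
    have sub: "vec.subspace (range (\<lambda>x. B *v x))"
      by (rule vec.subspace_image[OF vec.subspace_UNIV])
    have im: "h u \<in> range (\<lambda>x. B *v x)" if u: "u \<in> ?S" for u
    proof -
      obtain j where "u = axis j 1" using u by blast
      then have "h u = B *v axis j 1" by (simp only: Bax)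
      then show ?thesis by blast
    qed
    have "0 \<notin> ?S" by auto
    then have "h v \<in> range (\<lambda>x. B *v x)"
      by (intro preserves_lines_subspace[OF h _ _ v(1) sp sub]) (use im in auto)
    then obtain x where "h v = B *v x" by auto
    moreover obtain c where "w = c *s h v" using v by (auto simp: span_singleton_iff)
    ultimately have "w = B *v (c *s x)" by (simp add: vec.scale)
    then show ?thesis by blast
  qed
  then have "surj ((*v) B)" unfolding surj_def by blast
  then have B: "invertible B"
    by (metis invertible_right_inverse matrix_right_invertible_surjective)
  then obtain B' where B': "B ** B' = mat 1" "B' ** B = mat 1" by (auto simp: invertible_def)
  then have "invertible B'" by (auto simp: invertible_def)
  define h1 where "h1 v = B' *v h v" for v
  have h1: "preserves_lines h1" unfolding h1_def by (rule preserves_lines_matrix) fact+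
  have h1ax: "h1 (axis i 1) = axis i 1" for i
    unfolding h1_def Bax[symmetric] by (simp add: matrix_vector_mul_assoc B')
  then have ax: "h1 (axis i 1) \<in> vec.span {axis i 1}" for i by (simp add: vec.span_base)
  fix o' :: 'n
  define d where "d i = (let y = h1 (axis o' 1 + axis i 1) in y $ i / y $ o')" for i
  have hd: "h1 (axis o' 1 + axis i 1) = c *s (axis o' 1 + d i *s axis i 1)" (is "h1 ?b = _") and dnz: "d i \<noteq> 0"
    if i: "i \<noteq> o'" and c: "c = h1 (axis o' 1 + axis i 1) $ o'" for i c
  proof -
    have b: "?b $ o' = 1" "?b $ i = 1" using i by (auto simp: axis_nth_if)
    then have hb: "h1 ?b $ o' \<noteq> 0" "h1 ?b $ i \<noteq> 0"
      using preserves_lines_nth_nonzero[OF h1 ax] by (metis one_neq_zero)+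
    have b0: "?b \<noteq> 0" using b by (metis zero_index zero_neq_one)
    have "h1 ?b $ k = 0" if "k \<noteq> i" "k \<noteq> o'" for k
      using preserves_lines_nth_0[OF h1 ax b0, of k] that by (simp add: axis_nth_if)
    then show "h1 ?b = c *s (axis o' 1 + d i *s axis i 1)"
      using i hb by (auto simp: vec_eq_iff axis_nth_if d_def Let_def c)
    show "d i \<noteq> 0" using hb by (simp add: d_def Let_def)
  qed
  define diag :: "('n \<Rightarrow> 'a) \<Rightarrow> 'a^'n^'n" where "diag f = (\<chi> i j. if i = j then f i else 0)" for f
  have diag_mult: "diag f *v v = (\<chi> i. f i * v $ i)" for f v
  proof -
    have "(\<Sum>j\<in>UNIV. (if i = j then f i else 0) * v $ j) = f i * v $ i" for i
      by (subst sum.remove[of _ i]) auto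
    then show ?thesis by (simp add: diag_def matrix_vector_mult_def vec_eq_iff)
  qed
  define f where "f i = (if i = o' then 1 else d i)" for i
  have f0: "f i \<noteq> 0" for i using dnz by (auto simp: f_def)
  let ?D = "diag f" and ?D' = "diag (\<lambda>i. inverse (f i))"
  have DD': "?D ** ?D' = mat 1" "?D' ** ?D = mat 1"
    unfolding matrix_eq by (simp_all add: matrix_vector_mul_assoc[symmetric] diag_mult vec_eq_iff f0)
  then have D: "invertible ?D" "invertible ?D'" by (auto simp: invertible_def)
  have h2: "preserves_lines (\<lambda>v. ?D' *v h1 v)" by (rule preserves_lines_matrix) fact+
  obtain \<sigma> where \<sigma>: "field_automorphism \<sigma>" and h2\<sigma>: "\<And>v. v \<noteq> 0 \<Longrightarrow> ?D' *v h1 v \<in> vec.span {map_vec \<sigma> v}"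
  proof (rule preserves_lines_normalised[OF n h2])
    show "?D' *v h1 (axis i 1) \<in> vec.span {axis i 1}" for i
    proof -
      have "?D' *v h1 (axis i 1) = inverse (f i) *s axis i 1"
        by (auto simp: h1ax diag_mult vec_eq_iff axis_nth_if)
      then show ?thesis by (auto simp: span_singleton_iff)
    qed
    show "?D' *v h1 (axis o' 1 + axis i 1) \<in> vec.span {axis o' 1 + axis i 1}" if i: "i \<noteq> o'" for i
    proof -
      obtain c where "h1 (axis o' 1 + axis i 1) = c *s (axis o' 1 + d i *s axis i 1)"
        using hd[OF i refl] by blast
      then have "?D' *v h1 (axis o' 1 + axis i 1) = c *s (axis o' 1 + axis i 1)"
        using i dnz[OF i] by (auto simp: diag_mult vec_eq_iff axis_nth_if f_def)
      then show ?thesis unfolding span_singleton_iff by blast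
    qed
  qed blast
  show thesis
  proof (rule that[of "B ** ?D" \<sigma>])
    show "invertible (B ** ?D)" by (rule invertible_mult) fact+
    show "field_automorphism \<sigma>" by fact
    show "vec.span {h v} = vec.span {(B ** ?D) *v map_vec \<sigma> v}" if v: "v \<noteq> 0" for v
    proof -
      obtain c where c: "?D' *v h1 v = c *s map_vec \<sigma> v"
        using h2\<sigma>[OF v] by (auto simp: span_singleton_iff)
      have "h v = B *v (?D *v (?D' *v h1 v))"
        by (simp add: h1_def matrix_vector_mul_assoc DD' B' matrix_mul_assoc)
      also have "\<dots> = c *s ((B ** ?D) *v map_vec \<sigma> v)"
        by (simp add: c vec.scale matrix_vector_mul_assoc)
      finally have e: "h v = c *s ((B ** ?D) *v map_vec \<sigma> v)" .
      moreover have "h v \<noteq> 0" using preserves_lines_nonzero[OF h v] .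
      ultimately have "c \<noteq> 0" by auto
      then show ?thesis by (simp add: e span_scale_eq)
    qed
  qed
qed

section \<open>Automorphisms of the spectral incidence graph act on points by collineations\<close>

lemma SIG_verts_iff:
  "x \<in> pverts SIG \<longleftrightarrow> (\<exists>M\<in>eigen_matrices. x = Inl (mats.span {M})) \<or> (\<exists>v. v \<noteq> 0 \<and> x = Inr (vec.span {v}))"
  by (auto simp: SIG_def matrix_points_def proj_points_def)

lemma SIG_verts_matrix: "M \<in> eigen_matrices \<Longrightarrow> Inl (mats.span {M}) \<in> pverts SIG"
  and SIG_verts_point: "v \<noteq> 0 \<Longrightarrow> Inr (vec.span {v}) \<in> pverts SIG"
  by (auto simp: SIG_verts_iff)

lemma SIG_vert_cases:
  assumes "x \<in> pverts SIG"
  obtains (matrix) M where "M \<in> eigen_matrices" "x = Inl (mats.span {M})"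
    | (point) v where "v \<noteq> 0" "x = Inr (vec.span {v})"
  using assms by (auto simp: SIG_verts_iff)

lemma sig_edges_iff:
  assumes "M \<in> eigen_matrices"
  shows "(Inl (mats.span {M}), Inr (vec.span {v})) \<in> sig_edges \<longleftrightarrow> eigenvector M v"
proof
  assume "(Inl (mats.span {M}), Inr (vec.span {v})) \<in> sig_edges"
  then obtain N w where "mats.span {M} = mats.span {N}" "vec.span {v} = vec.span {w}" "eigenvector N w"
    by (auto simp: sig_edges_def)
  moreover have "M \<noteq> 0" using assms by (simp add: eigen_matrices_def)
  ultimately show "eigenvector M v"
    using eigenvector_mats_span_cong eigenvector_span_cong by blast
qed (use assms in \<open>auto simp: sig_edges_def\<close>)

lemma SIG_arc_iff:
  assumes "M \<in> eigen_matrices"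
  shows "(Inl (mats.span {M}), Inr (vec.span {v})) \<in> parcs SIG \<longleftrightarrow> eigenvector M v"
    and "(Inr (vec.span {v}), Inl (mats.span {M})) \<in> parcs SIG \<longleftrightarrow> eigenvector M v"
  using sig_edges_iff[OF assms, of v] by (auto simp: SIG_def) (auto simp: sig_edges_def)

lemma SIG_no_arc: "(Inl m, Inl m') \<notin> parcs SIG" "(Inr p, Inr p') \<notin> parcs SIG"
  by (auto simp: SIG_def sig_edges_def)

lemma SIG_arc_sym: "(x, y) \<in> parcs SIG \<longleftrightarrow> (y, x) \<in> parcs SIG"
  by (auto simp: SIG_def)

lemma aut_groupD:
  assumes "\<phi> \<in> carrier (aut_group G)"
  shows "bij_betw \<phi> (pverts G) (pverts G)" and "\<phi> \<in> extensional (pverts G)"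
    and "x \<in> pverts G \<Longrightarrow> y \<in> pverts G \<Longrightarrow> (\<phi> x, \<phi> y) \<in> parcs G \<longleftrightarrow> (x, y) \<in> parcs G"
    and "x \<in> pverts G \<Longrightarrow> \<phi> x \<in> pverts G"
  using assms by (auto simp: aut_group_def Bij_def dest: bij_betwE)

lemma mat_1_eigen_matrix:
  shows "mat 1 \<in> (eigen_matrices :: ('a::field^'n^'n) set)" and "v \<noteq> 0 \<Longrightarrow> eigenvector (mat 1 :: 'a^'n^'n) v"
proof -
  show e: "eigenvector (mat 1 :: 'a^'n^'n) v" if "v \<noteq> 0" for v
    using that by (auto simp: eigenvector_def intro!: exI[of _ 1])
  have "(mat 1 :: 'a^'n^'n) \<noteq> 0" by (auto simp: vec_eq_iff mat_def)
  then show "mat 1 \<in> (eigen_matrices :: ('a^'n^'n) set)"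
    using e[of "axis undefined 1"] by (auto simp: eigen_matrices_def)
qed

lemma eigen_matrix_avoiding_point:
  fixes p :: "'a::field^'n"
  assumes n: "CARD('n) \<ge> 2" and "p \<noteq> 0"
  obtains M where "M \<in> eigen_matrices" and "\<not> eigenvector M p"
proof -
  obtain k where k: "p $ k \<noteq> 0" using \<open>p \<noteq> 0\<close> by (auto simp: vec_eq_iff)
  have "card (UNIV - {k}) \<ge> 1" using n by (simp add: card_Diff_singleton)
  then have "UNIV - {k} \<noteq> {}" by (metis card.empty not_one_le_zero)
  then obtain l where l: "l \<noteq> k" by auto
  let ?M = "outer_product (axis l (1::'a)) (axis k 1)"
  have f: "(\<Sum>j\<in>UNIV. axis k 1 $ j * v $ j) = v $ k" for v :: "'a^'n"
    by (subst sum.remove[of _ k]) (auto simp: axis_nth_if)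
  have e: "eigenvector ?M (axis l 1)" using l by (subst eigenvector_outer_product) (auto simp: vec.span_base)
  have "?M $ l $ k \<noteq> 0" by (simp add: outer_product_def axis_nth_if)
  then have "?M \<noteq> 0" by (metis zero_index)
  with e have "?M \<in> eigen_matrices" by (auto simp: eigen_matrices_def)
  moreover have "\<not> eigenvector ?M p"
    using k l eigenvector_outer_product[OF _ \<open>p \<noteq> 0\<close>, of "axis l 1" "axis k 1", unfolded f]
    by (auto simp: span_singleton_iff axis_nth_if)
  ultimately show thesis by (rule that)
qed

text \<open>The graph is connected through the identity matrix, so an automorphism could at most exchange the
  two parts. The identity matrix is adjacent to the whole other part, but no point is.\<close>

lemma aut_point_to_point:
  fixes \<phi> :: "('a::field, 'n::finite) sig_vertex \<Rightarrow> ('a, 'n) sig_vertex"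
  assumes n: "CARD('n) \<ge> 2" and \<phi>: "\<phi> \<in> carrier (aut_group SIG)" and v: "v \<noteq> 0"
  obtains w where "w \<noteq> 0" and "\<phi> (Inr (vec.span {v})) = Inr (vec.span {w})"
proof -
  let ?I = "Inl (mats.span {mat 1}) :: ('a, 'n) sig_vertex"
  note I = mat_1_eigen_matrix[where ?'a = 'a and ?'n = 'n]
  note [simp] = SIG_verts_matrix SIG_verts_point
  have adjI: "(\<phi> ?I, \<phi> (Inr (vec.span {x}))) \<in> parcs SIG" if "x \<noteq> 0" for x
    using aut_groupD(3)[OF \<phi>, of ?I "Inr (vec.span {x})"] that I by (simp add: SIG_arc_iff)
  have "\<phi> ?I \<in> pverts SIG" using aut_groupD(4)[OF \<phi>] I by simp
  then show thesis
  proof (cases rule: SIG_vert_cases)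
    case (matrix N)
    have "\<phi> (Inr (vec.span {v})) \<in> pverts SIG" using aut_groupD(4)[OF \<phi>] v by simp
    then show thesis
    proof (cases rule: SIG_vert_cases)
      case (matrix N')
      then show thesis using adjI[OF v] \<open>\<phi> ?I = _\<close> SIG_no_arc by metis
    qed (use that in blast)
  next
    case (point p)
    obtain M where M: "M \<in> eigen_matrices" "\<not> eigenvector M p"
      using eigen_matrix_avoiding_point[OF n point(1)] by blast
    have "Inl (mats.span {M}) \<in> \<phi> ` pverts SIG"
      using aut_groupD(1)[OF \<phi>] M by (simp add: bij_betw_def)
    then obtain y where y: "y \<in> pverts SIG" "\<phi> y = Inl (mats.span {M})" by (metis imageE)
    from y(1) have "(\<phi> ?I, \<phi> y) \<in> parcs SIG"
    proof (cases rule: SIG_vert_cases)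
      case (point x)
      then show ?thesis using adjI by simp
    next
      case (matrix N)
      then obtain x where x: "eigenvector N x" by (auto simp: eigen_matrices_def)
      then have x0: "x \<noteq> 0" by (simp add: eigenvector_def)
      have 1: "(\<phi> y, \<phi> (Inr (vec.span {x}))) \<in> parcs SIG"
        using aut_groupD(3)[OF \<phi> y(1), of "Inr (vec.span {x})"] matrix x x0 by (simp add: SIG_arc_iff)
      have "\<phi> (Inr (vec.span {x})) \<in> pverts SIG" using aut_groupD(4)[OF \<phi>] x0 by simp
      then show ?thesis
      proof (cases rule: SIG_vert_cases)
        case (matrix N')
        then show ?thesis using 1 y SIG_no_arc by metis
      next
        case (point z)
        then show ?thesis using adjI[OF x0] \<open>\<phi> ?I = _\<close> SIG_no_arc by metis
      qed
    qed
    then have "eigenvector M p" using point y M SIG_arc_iff(2)[OF M(1), of p] by simp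
    with M show thesis by simp
  qed
qed

lemma aut_matrix_to_matrix:
  fixes \<phi> :: "('a::field, 'n::finite) sig_vertex \<Rightarrow> ('a, 'n) sig_vertex"
  assumes n: "CARD('n) \<ge> 2" and \<phi>: "\<phi> \<in> carrier (aut_group SIG)" and M: "M \<in> eigen_matrices"
  obtains N where "N \<in> eigen_matrices" and "\<phi> (Inl (mats.span {M})) = Inl (mats.span {N})"
proof -
  obtain x where x: "eigenvector M x" using M by (auto simp: eigen_matrices_def)
  then have x0: "x \<noteq> 0" by (simp add: eigenvector_def)
  obtain w where w: "\<phi> (Inr (vec.span {x})) = Inr (vec.span {w})"
    using aut_point_to_point[OF n \<phi> x0] by blast
  have 1: "(\<phi> (Inl (mats.span {M})), \<phi> (Inr (vec.span {x}))) \<in> parcs SIG"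
    using aut_groupD(3)[OF \<phi> SIG_verts_matrix[OF M] SIG_verts_point[OF x0]] x M by (simp add: SIG_arc_iff)
  have "\<phi> (Inl (mats.span {M})) \<in> pverts SIG" using aut_groupD(4)[OF \<phi> SIG_verts_matrix[OF M]] .
  then show thesis
  proof (cases rule: SIG_vert_cases)
    case (point z)
    then show thesis using 1 w SIG_no_arc by metis
  qed (use that in blast)
qed

text \<open>If \<open>h u\<close> were off the line through \<open>h v\<close> and \<open>h w\<close>, it could be adjoined to the
  eigenvectors of some matrix that has \<open>h v\<close> and \<open>h w\<close> among them. Pulling the matrices back along
  the automorphism adjoins \<open>u\<close> on the line through \<open>v\<close> and \<open>w\<close>.\<close>

lemma aut_preserves_lines:
  fixes h :: "'a::field^'n::finite \<Rightarrow> 'a^'n"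
  assumes n: "CARD('n) \<ge> 2" and \<phi>: "\<phi> \<in> carrier (aut_group SIG)"
    and h0: "\<And>v. v \<noteq> 0 \<Longrightarrow> h v \<noteq> 0"
    and h: "\<And>v. v \<noteq> 0 \<Longrightarrow> \<phi> (Inr (vec.span {v})) = Inr (vec.span {h v})"
    and onto: "\<And>w. w \<noteq> 0 \<Longrightarrow> \<exists>v. v \<noteq> 0 \<and> w \<in> vec.span {h v}"
  shows "preserves_lines h"
  unfolding preserves_lines_def
proof (intro conjI allI impI)
  fix u v w :: "'a^'n"
  assume u: "u \<noteq> 0" and v: "v \<noteq> 0" and w: "w \<noteq> 0" and uvw: "u \<in> vec.span {v, w}"
  have inj: "vec.span {h x} = vec.span {h y} \<longleftrightarrow> vec.span {x} = vec.span {y}" if "x \<noteq> 0" "y \<noteq> 0" for x y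
    using inj_on_eq_iff[OF bij_betw_imp_inj_on[OF aut_groupD(1)[OF \<phi>]] SIG_verts_point[OF that(1)] SIG_verts_point[OF that(2)]]
      h[OF that(1)] h[OF that(2)] by simp
  have mem: "h x \<in> vec.span {h y} \<longleftrightarrow> x \<in> vec.span {y}" if "x \<noteq> 0" "y \<noteq> 0" for x y
    using inj[OF that] that h0[of x] h0[of y] by (simp add: span_singleton_eq_iff)
  have pullback: "\<exists>N\<in>eigen_matrices. \<forall>x. x \<noteq> 0 \<longrightarrow> (eigenvector N x \<longleftrightarrow> eigenvector M (h x))"
    if M: "M \<in> eigen_matrices" for M
  proof -
    have "Inl (mats.span {M}) \<in> \<phi> ` pverts SIG"
      using aut_groupD(1)[OF \<phi>] SIG_verts_matrix[OF M] by (simp add: bij_betw_def)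
    then obtain y where y: "y \<in> pverts SIG" "\<phi> y = Inl (mats.span {M})" by (metis imageE)
    from y(1) show ?thesis
    proof (cases rule: SIG_vert_cases)
      case (matrix N)
      have "eigenvector N x \<longleftrightarrow> eigenvector M (h x)" if x: "x \<noteq> 0" for x
        using aut_groupD(3)[OF \<phi> y(1) SIG_verts_point[OF x]] matrix y h[OF x] M by (simp add: SIG_arc_iff)
      with matrix show ?thesis by blast
    qed (use h y in auto)
  qed
  show "h u \<in> vec.span {h v, h w}"
  proof (rule ccontr)
    assume off: "h u \<notin> vec.span {h v, h w}"
    then have "h u \<notin> vec.span {h v}" "h u \<notin> vec.span {h w}"
      using vec.span_mono[of "{h v}" "{h v, h w}"] vec.span_mono[of "{h w}" "{h v, h w}"] by auto
    then have nu: "u \<notin> vec.span {v}" "u \<notin> vec.span {w}" using mem u v w by auto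
    obtain a b where ab: "u = a *s v + b *s w" using uvw by (auto simp: span_pair_iff)
    have a0: "a \<noteq> 0" and b0: "b \<noteq> 0" using ab nu by (auto simp: span_singleton_iff)
    have nwv: "w \<notin> vec.span {v}"
    proof
      assume "w \<in> vec.span {v}"
      then have "u \<in> vec.span {v}" unfolding ab by (intro vec.span_add vec.span_scale) (auto simp: vec.span_base)
      with nu show False by simp
    qed
    obtain M M' s where M: "M \<in> eigen_matrices" and M': "M' \<in> eigen_matrices"
      and E: "eigenvector M (h v)" "eigenvector M (h w)" "\<not> eigenvector M (h u)"
      and s: "eigenvector M s" "s \<notin> vec.span {h v}" "s \<notin> vec.span {h w}"
      and MM': "\<And>x. x \<noteq> 0 \<Longrightarrow> eigenvector M' x \<longleftrightarrow> eigenvector M x \<or> x \<in> vec.span {h u}"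
      using eigenvector_adjoined_off_line[OF h0[OF v] _ off] mem[OF w v] nwv by blast
    obtain N where N: "\<And>x. x \<noteq> 0 \<Longrightarrow> eigenvector N x \<longleftrightarrow> eigenvector M (h x)" using pullback[OF M] by blast
    obtain N' where N': "\<And>x. x \<noteq> 0 \<Longrightarrow> eigenvector N' x \<longleftrightarrow> eigenvector M' (h x)" using pullback[OF M'] by blast
    have "s \<noteq> 0" using s by (simp add: eigenvector_def)
    then obtain t where t: "t \<noteq> 0" "s \<in> vec.span {h t}" using onto by blast
    then have st: "vec.span {s} = vec.span {h t}" using \<open>s \<noteq> 0\<close> h0 by (simp add: span_singleton_eq_iff)
    have nt: "t \<notin> vec.span {x}" if x: "x \<noteq> 0" and sx: "s \<notin> vec.span {h x}" for x
      using mem[OF t(1) x] sx st span_singleton_eq_iff[OF \<open>s \<noteq> 0\<close>, of "h x"] h0[OF x]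
        span_singleton_eq_iff[OF h0[OF t(1)], of "h x"] by auto
    show False
    proof (rule no_eigenvector_adjoined_on_line[of "a *s v" "b *s w" N t N'])
      show "a *s v \<noteq> 0" using a0 v by simp
      show "b *s w \<notin> vec.span {a *s v}" using nwv a0 b0 by (simp add: scale_mem_span_iff span_scale_eq)
      show "eigenvector N (a *s v)" "eigenvector N (b *s w)"
        using N[OF v] N[OF w] E a0 b0 by (simp_all add: eigenvector_scale)
      show "\<not> eigenvector N (a *s v + b *s w)" using N[OF u] E by (simp add: ab)
      show "eigenvector N t" using N[OF t(1)] eigenvector_span_cong[OF st] s by simp
      show "t \<notin> vec.span {a *s v}" "t \<notin> vec.span {b *s w}"
        using nt[OF v] nt[OF w] s a0 b0 by (simp_all add: span_scale_eq)
      show "eigenvector N' x \<longleftrightarrow> eigenvector N x \<or> x \<in> vec.span {a *s v + b *s w}" if x: "x \<noteq> 0" for x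
        using N[OF x] N'[OF x] MM'[OF h0[OF x]] mem[OF x u] by (simp add: ab)
    qed
  qed
qed (rule h0)

lemma aut_semilinear:
  fixes \<phi> :: "('a::{field,finite}, 'n::finite) sig_vertex \<Rightarrow> ('a, 'n) sig_vertex"
  assumes n: "CARD('n) \<ge> 3" and \<phi>: "\<phi> \<in> carrier (aut_group SIG)"
  obtains A \<sigma> where "invertible A" and "field_automorphism \<sigma>"
    and "\<And>v. v \<noteq> 0 \<Longrightarrow> \<phi> (Inr (vec.span {v})) = Inr (vec.span {A *v map_vec \<sigma> v})"
proof -
  have n2: "CARD('n) \<ge> 2" using n by simp
  have "\<forall>v. \<exists>w. v \<noteq> 0 \<longrightarrow> w \<noteq> 0 \<and> \<phi> (Inr (vec.span {v})) = Inr (vec.span {w})"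
    using aut_point_to_point[OF n2 \<phi>] by metis
  then obtain h where h0: "\<And>v. v \<noteq> 0 \<Longrightarrow> h v \<noteq> 0"
    and h: "\<And>v. v \<noteq> 0 \<Longrightarrow> \<phi> (Inr (vec.span {v})) = Inr (vec.span {h v})"
    by metis
  have onto: "\<exists>v. v \<noteq> 0 \<and> w \<in> vec.span {h v}" if w: "w \<noteq> 0" for w
  proof -
    have "Inr (vec.span {w}) \<in> \<phi> ` pverts SIG"
      using aut_groupD(1)[OF \<phi>] SIG_verts_point[OF w] by (simp add: bij_betw_def)
    then obtain y where y: "y \<in> pverts SIG" "\<phi> y = Inr (vec.span {w})" by (metis imageE)
    from y(1) show ?thesis
    proof (cases rule: SIG_vert_cases)
      case (matrix M)
      then show ?thesis using aut_matrix_to_matrix[OF n2 \<phi> matrix(1)] y by auto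
    next
      case (point v)
      then have "vec.span {w} = vec.span {h v}" using h y by simp
      then show ?thesis using w point span_singleton_eq_iff by blast
    qed
  qed
  have "preserves_lines h" by (rule aut_preserves_lines[OF n2 \<phi> h0 h onto])
  from preserves_lines_semilinear[OF n this onto] obtain A \<sigma> where "invertible A" "field_automorphism \<sigma>"
    and "\<And>v. v \<noteq> 0 \<Longrightarrow> vec.span {h v} = vec.span {A *v map_vec \<sigma> v}" by blast
  with h that show thesis by simp
qed

section \<open>The group of semilinear permutations\<close>

lemma field_automorphism_simps:
  assumes "field_automorphism \<sigma>"
  shows "\<sigma> (x + y) = \<sigma> x + \<sigma> y" "\<sigma> (x * y) = \<sigma> x * \<sigma> y" "\<sigma> 0 = 0" "\<sigma> 1 = 1"
    "\<sigma> x = \<sigma> y \<longleftrightarrow> x = y" "\<sigma> x = 0 \<longleftrightarrow> x = 0" "\<sigma> (\<Sum>i\<in>I. f i) = (\<Sum>i\<in>I. \<sigma> (f i))"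
proof -
  have \<sigma>: "bij \<sigma>" "\<sigma> (x + y) = \<sigma> x + \<sigma> y" "\<sigma> (x * y) = \<sigma> x * \<sigma> y" for x y
    using assms by (auto simp: field_automorphism_def)
  show add: "\<sigma> (x + y) = \<sigma> x + \<sigma> y" "\<sigma> (x * y) = \<sigma> x * \<sigma> y" for x y by (fact \<sigma>)+
  have "\<sigma> 0 + 0 = \<sigma> 0 + \<sigma> 0" using \<sigma>(2)[of 0 0] by (simp only: add_0_right)
  then show 0: "\<sigma> 0 = 0" by (metis add_left_cancel)
  show inj: "\<sigma> x = \<sigma> y \<longleftrightarrow> x = y" for x y using \<sigma>(1) by (simp add: bij_def inj_eq)
  show "\<sigma> x = 0 \<longleftrightarrow> x = 0" using inj[of x 0] 0 by simp
  have "\<sigma> 1 * \<sigma> 1 = \<sigma> 1 * 1" using \<sigma>(3)[of 1 1] by simp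
  moreover have "\<sigma> 1 \<noteq> 0" using inj[of 1 0] 0 by simp
  ultimately show "\<sigma> 1 = 1" by (metis mult_left_cancel)
  show "\<sigma> (\<Sum>i\<in>I. f i) = (\<Sum>i\<in>I. \<sigma> (f i))"
    by (induction I rule: infinite_finite_induct) (simp_all add: 0 \<sigma>)
qed

lemma field_automorphism_id: "field_automorphism id"
  by (simp add: field_automorphism_def)

lemma field_automorphism_comp: "field_automorphism \<sigma> \<Longrightarrow> field_automorphism \<tau> \<Longrightarrow> field_automorphism (\<sigma> \<circ> \<tau>)"
  by (simp add: field_automorphism_def bij_comp)

lemma field_automorphism_inv:
  assumes \<sigma>: "field_automorphism \<sigma>"
  shows "field_automorphism (inv_into UNIV \<sigma>)" and "inv_into UNIV \<sigma> \<circ> \<sigma> = id" and "\<sigma> (inv_into UNIV \<sigma> x) = x" and "inv_into UNIV \<sigma> (\<sigma> x) = x"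
proof -
  have b: "bij \<sigma>" using \<sigma> by (simp add: field_automorphism_def)
  show 1: "\<sigma> (inv_into UNIV \<sigma> x) = x" and 2: "inv_into UNIV \<sigma> (\<sigma> x) = x" for x
    using b by (simp_all add: bij_is_surj surj_f_inv_f bij_is_inj)
  show "inv_into UNIV \<sigma> \<circ> \<sigma> = id" by (simp add: fun_eq_iff 2)
  show "field_automorphism (inv_into UNIV \<sigma>)"
    unfolding field_automorphism_def
  proof (intro conjI allI)
    show "bij (inv_into UNIV \<sigma>)" by (rule bij_imp_bij_inv[OF b])
    show "inv_into UNIV \<sigma> (x + y) = inv_into UNIV \<sigma> x + inv_into UNIV \<sigma> y" for x y
      by (metis 1 2 field_automorphism_simps(1)[OF \<sigma>])
    show "inv_into UNIV \<sigma> (x * y) = inv_into UNIV \<sigma> x * inv_into UNIV \<sigma> y" for x y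
      by (metis 1 2 field_automorphism_simps(2)[OF \<sigma>])
  qed
qed

lemma map_vec_matrix_vector_mult:
  "field_automorphism \<sigma> \<Longrightarrow> map_vec \<sigma> (A *v v) = map_matrix \<sigma> A *v map_vec \<sigma> v"
  by (simp add: vec_eq_iff matrix_vector_mult_def field_automorphism_simps)

lemma map_matrix_mult:
  "field_automorphism \<sigma> \<Longrightarrow> map_matrix \<sigma> (A ** B) = map_matrix \<sigma> A ** map_matrix \<sigma> B"
  by (simp add: vec_eq_iff matrix_matrix_mult_def field_automorphism_simps)

lemma map_matrix_mat_1: "field_automorphism \<sigma> \<Longrightarrow> map_matrix \<sigma> (mat 1) = mat 1"
  by (simp add: vec_eq_iff mat_def field_automorphism_simps)

lemma map_vec_eq_0_iff: "field_automorphism \<sigma> \<Longrightarrow> map_vec \<sigma> v = 0 \<longleftrightarrow> v = 0"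
  by (simp add: vec_eq_iff field_automorphism_simps)

lemma map_vec_scale: "field_automorphism \<sigma> \<Longrightarrow> map_vec \<sigma> (c *s v) = \<sigma> c *s map_vec \<sigma> v"
  by (simp add: vec_eq_iff field_automorphism_simps)

lemma map_matrix_scale: "field_automorphism \<sigma> \<Longrightarrow> map_matrix \<sigma> (mat_scale c A) = mat_scale (\<sigma> c) (map_matrix \<sigma> A)"
  by (simp add: vec_eq_iff mat_scale_def field_automorphism_simps)

lemma invertible_map_matrix:
  assumes "field_automorphism \<sigma>" and "invertible A"
  shows "invertible (map_matrix \<sigma> A)"
  using assms by (metis invertible_def map_matrix_mat_1 map_matrix_mult)

lemma mat_vector_mult: "mat c *v v = c *s (v :: 'a::field^'n)"
proof -
  have "(\<Sum>j\<in>UNIV. (if i = j then c else 0) * v $ j) = c * v $ i" for i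
    by (subst sum.remove[of _ i]) auto
  then show ?thesis by (simp add: matrix_vector_mult_def mat_def vec_eq_iff)
qed

lemma mat_mult_eq_scale: "mat c ** A = mat_scale c (A :: 'a::field^'n^'n)" "A ** mat c = mat_scale c A"
  unfolding matrix_eq
  by (simp_all add: mat_scale_vector_mult matrix_vector_mul_assoc[symmetric] mat_vector_mult vec.scale)

lemma matrix_scale_left: "mat_scale c A ** B = mat_scale c (A ** (B :: 'a::field^'n^'n))"
  and matrix_scale_right: "A ** mat_scale c B = mat_scale c (A ** (B :: 'a::field^'n^'n))"
  unfolding matrix_eq by (simp_all add: mat_scale_vector_mult matrix_vector_mul_assoc[symmetric] vec.scale)

lemma mat_scale_mat_1: "mat_scale c (mat 1) = (mat c :: 'a::field^'n^'n)"
  by (metis mat_mult_eq_scale(1) matrix_mul_rid)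

lemma invertible_mult_vector_eq_0: "invertible A \<Longrightarrow> A *v v = 0 \<longleftrightarrow> v = (0 :: 'a::field^'n)"
  using inj_eq[OF inj_matrix_vector_mult, of A v 0] by simp

text \<open>These are the cosets of the scalar matrices, that is, the elements of the projective group.\<close>

definition scalar_class :: "'a::field^'n^'n \<Rightarrow> ('a^'n^'n) set" where
  "scalar_class A = {mat_scale c A | c. c \<noteq> 0}"

lemma scalar_class_self: "A \<in> scalar_class A"
  unfolding scalar_class_def by (auto intro!: exI[of _ 1])

lemma scalar_class_scale: "c \<noteq> 0 \<Longrightarrow> scalar_class (mat_scale c A) = scalar_class A"
  unfolding scalar_class_def
  by (auto simp: mats.scale_scale) (metis divide_eq_0_iff nonzero_eq_divide_eq)

lemma group_GL: "group (GL :: ('a::field^'n^'n) monoid)"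
proof (rule groupI; simp add: GL_def)
  show "A ** B ** C = A ** (B ** C)" for A B C :: "'a^'n^'n" by (simp add: matrix_mul_assoc)
  show "\<exists>B. invertible B \<and> B ** A = mat 1" if "invertible A" for A :: "'a^'n^'n"
    using that unfolding invertible_def by blast
  show "invertible (A ** B)" if "invertible A" "invertible B" for A B :: "'a^'n^'n"
    using that by (rule invertible_mult)
  show "invertible (mat 1 :: 'a^'n^'n)" by (auto simp: invertible_def)
qed

lemma normal_scalars: "{mat c | c. c \<noteq> 0} \<lhd> (GL :: ('a::field^'n^'n) monoid)"
proof -
  interpret group "GL :: ('a^'n^'n) monoid" by (rule group_GL)
  have mm: "mat a ** mat b = (mat (a * b) :: 'a^'n^'n)" for a b
    by (simp add: mat_mult_eq_scale) (simp add: mat_scale_def mat_def vec_eq_iff)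
  have inv: "invertible (mat c :: 'a^'n^'n)" if "c \<noteq> 0" for c
    using that mm[of c "inverse c"] mm[of "inverse c" c] by (auto simp: invertible_def)
  show ?thesis
  proof (rule normalI)
    show "subgroup {mat c | c. c \<noteq> 0} (GL :: ('a^'n^'n) monoid)"
    proof (rule subgroupI)
      show "{mat c | c. c \<noteq> 0} \<subseteq> carrier (GL :: ('a^'n^'n) monoid)" using inv by (auto simp: GL_def)
      show "{mat c :: 'a^'n^'n | c. c \<noteq> 0} \<noteq> {}" by (auto intro: exI[of _ 1])
    next
      fix a :: "'a^'n^'n" assume "a \<in> {mat c | c. c \<noteq> 0}"
      then obtain c where c: "a = mat c" "c \<noteq> 0" by auto
      have "inv\<^bsub>GL\<^esub> a = mat (inverse c)"
        by (rule inv_equality) (use c mm inv in \<open>auto simp: GL_def\<close>)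
      then show "inv\<^bsub>GL\<^esub> a \<in> {mat c | c. c \<noteq> 0}" using c by auto
    next
      fix a b :: "'a^'n^'n" assume "a \<in> {mat c | c. c \<noteq> 0}" "b \<in> {mat c | c. c \<noteq> 0}"
      then show "a \<otimes>\<^bsub>GL\<^esub> b \<in> {mat c | c. c \<noteq> 0}" by (auto simp: GL_def mm)
    qed
    show "\<forall>x\<in>carrier GL. {mat c | c. c \<noteq> 0} #>\<^bsub>GL\<^esub> x = x <#\<^bsub>GL\<^esub> {mat c :: 'a^'n^'n | c. c \<noteq> 0}"
      by (auto simp: r_coset_def l_coset_def GL_def mat_mult_eq_scale)
  qed
qed

lemma scalar_class_eq_coset: "{mat c | c. c \<noteq> 0} #>\<^bsub>GL\<^esub> A = scalar_class A"
  by (auto simp: r_coset_def scalar_class_def GL_def mat_mult_eq_scale)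

lemma carrier_PGL: "carrier PGL = {scalar_class A | A. invertible A}"
  by (auto simp: PGL_def carrier_FactGroup scalar_class_eq_coset) (auto simp: GL_def)

lemma mult_PGL: "invertible A \<Longrightarrow> invertible B \<Longrightarrow> scalar_class A \<otimes>\<^bsub>PGL\<^esub> scalar_class B = scalar_class (A ** B)"
  using normal.rcos_sum[OF normal_scalars, of A B]
  by (simp add: PGL_def scalar_class_eq_coset) (simp add: GL_def)

lemma one_PGL: "\<one>\<^bsub>PGL\<^esub> = scalar_class (mat 1 :: 'a::field^'n^'n)"
  by (simp add: PGL_def scalar_class_def mat_scale_mat_1)

lemma map_matrix_scalar_class:
  assumes \<sigma>: "field_automorphism \<sigma>"
  shows "map_matrix \<sigma> ` scalar_class A = scalar_class (map_matrix \<sigma> A)"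
proof
  show "map_matrix \<sigma> ` scalar_class A \<subseteq> scalar_class (map_matrix \<sigma> A)"
    using field_automorphism_simps(6)[OF \<sigma>] by (auto simp: scalar_class_def map_matrix_scale[OF \<sigma>])
  show "scalar_class (map_matrix \<sigma> A) \<subseteq> map_matrix \<sigma> ` scalar_class A"
  proof
    fix X assume "X \<in> scalar_class (map_matrix \<sigma> A)"
    then obtain c where c: "X = mat_scale c (map_matrix \<sigma> A)" "c \<noteq> 0" by (auto simp: scalar_class_def)
    then have "X = map_matrix \<sigma> (mat_scale (inv_into UNIV \<sigma> c) A)"
      by (simp add: map_matrix_scale[OF \<sigma>] field_automorphism_inv[OF \<sigma>])
    moreover have "inv_into UNIV \<sigma> c \<noteq> 0"
      using c field_automorphism_simps(6)[OF field_automorphism_inv(1)[OF \<sigma>]] by simp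
    ultimately show "X \<in> map_matrix \<sigma> ` scalar_class A" by (auto simp: scalar_class_def)
  qed
qed

lemma carrier_PGammaL: "carrier PGammaL = {(scalar_class A, \<sigma>) | A \<sigma>. invertible A \<and> field_automorphism \<sigma>}"
  by (auto simp: PGammaL_def semidirect_def carrier_PGL field_aut_group_def field_automorphism_def)

lemma PGammaL_memI: "invertible A \<Longrightarrow> field_automorphism \<sigma> \<Longrightarrow> (scalar_class A, \<sigma>) \<in> carrier PGammaL"
  by (auto simp: carrier_PGammaL)

lemma mult_PGammaL:
  assumes "invertible A" "invertible B" "field_automorphism \<sigma>"
  shows "(scalar_class A, \<sigma>) \<otimes>\<^bsub>PGammaL\<^esub> (scalar_class B, \<tau>) = (scalar_class (A ** map_matrix \<sigma> B), \<sigma> \<circ> \<tau>)"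
  using assms by (simp add: PGammaL_def semidirect_def map_matrix_scalar_class mult_PGL invertible_map_matrix field_aut_group_def)

lemma one_PGammaL: "\<one>\<^bsub>PGammaL\<^esub> = (scalar_class (mat 1), id)"
  by (simp add: PGammaL_def semidirect_def one_PGL field_aut_group_def)

lemma PGammaL_cases:
  assumes "g \<in> carrier PGammaL"
  obtains A \<sigma> where "g = (scalar_class A, \<sigma>)" "invertible A" "field_automorphism \<sigma>"
  using assms by (auto simp: carrier_PGammaL)

lemma group_PGammaL: "group (PGammaL :: (('a::field^'n^'n) set \<times> ('a \<Rightarrow> 'a)) monoid)"
proof (rule groupI)
  note closed = invertible_mult invertible_map_matrix field_automorphism_comp
  fix x y z :: "('a^'n^'n) set \<times> ('a \<Rightarrow> 'a)"
  assume x: "x \<in> carrier PGammaL"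
  obtain A \<sigma> where A: "x = (scalar_class A, \<sigma>)" "invertible A" "field_automorphism \<sigma>"
    using x by (rule PGammaL_cases)
  show "\<one>\<^bsub>PGammaL\<^esub> \<otimes>\<^bsub>PGammaL\<^esub> x = x"
  proof -
    have "map_matrix id A = A" by (simp add: vec_eq_iff)
    moreover have "invertible (mat 1 :: 'a^'n^'n)" by (auto simp: invertible_def)
    ultimately show ?thesis using A by (simp add: one_PGammaL mult_PGammaL field_automorphism_id)
  qed
  show "\<exists>y\<in>carrier PGammaL. y \<otimes>\<^bsub>PGammaL\<^esub> x = \<one>\<^bsub>PGammaL\<^esub>"
  proof -
    obtain B where B: "A ** B = mat 1" "B ** A = mat 1" using A by (auto simp: invertible_def)
    then have iB: "invertible B" by (auto simp: invertible_def)
    note \<sigma>' = field_automorphism_inv[OF A(3)]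
    let ?y = "(scalar_class (map_matrix (inv_into UNIV \<sigma>) B), inv_into UNIV \<sigma>)"
    have "?y \<in> carrier PGammaL" 
      using \<sigma>'(1) iB by (intro PGammaL_memI invertible_map_matrix)
    moreover have "?y \<otimes>\<^bsub>PGammaL\<^esub> x = \<one>\<^bsub>PGammaL\<^esub>"
      using A \<sigma>' iB B by (simp add: mult_PGammaL one_PGammaL invertible_map_matrix map_matrix_mat_1 flip: map_matrix_mult)
    ultimately show ?thesis by blast
  qed
  assume y: "y \<in> carrier PGammaL"
  obtain B \<tau> where B: "y = (scalar_class B, \<tau>)" "invertible B" "field_automorphism \<tau>"
    using y by (rule PGammaL_cases)
  show "x \<otimes>\<^bsub>PGammaL\<^esub> y \<in> carrier PGammaL"
    using A B by (simp add: mult_PGammaL PGammaL_memI closed)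
  assume z: "z \<in> carrier PGammaL"
  obtain C \<rho> where C: "z = (scalar_class C, \<rho>)" "invertible C" "field_automorphism \<rho>"
    using z by (rule PGammaL_cases)
  have "map_matrix (\<sigma> \<circ> \<tau>) C = map_matrix \<sigma> (map_matrix \<tau> C)" by (simp add: vec_eq_iff)
  then show "x \<otimes>\<^bsub>PGammaL\<^esub> y \<otimes>\<^bsub>PGammaL\<^esub> z = x \<otimes>\<^bsub>PGammaL\<^esub> (y \<otimes>\<^bsub>PGammaL\<^esub> z)"
    using A B C by (simp add: mult_PGammaL closed map_matrix_mult matrix_mul_assoc comp_assoc)
qed (auto simp: one_PGammaL carrier_PGammaL field_automorphism_id invertible_def intro!: exI[of _ "mat 1"])

lemma restricts_to_iff:
  fixes A :: "'a::field^'n::finite^'n"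
  shows "restricts_to \<phi> (scalar_class A, \<sigma>) \<longleftrightarrow>
    (\<forall>v. v \<noteq> 0 \<longrightarrow> \<phi> (Inr (vec.span {v})) = Inr (vec.span {A *v map_vec \<sigma> v}))"
proof -
  have "vec.span {B *v w} = vec.span {A *v w}" if "B \<in> scalar_class A" for B w
    using that by (auto simp: scalar_class_def mat_scale_vector_mult span_scale_eq)
  note span = this
  show ?thesis
    unfolding restricts_to_def fst_conv snd_conv
  proof (intro iffI ballI allI impI)
    fix v :: "'a^'n"
    assume "\<forall>B\<in>scalar_class A. \<forall>v. v \<noteq> 0 \<longrightarrow> \<phi> (Inr (vec.span {v})) = Inr (vec.span {B *v map_vec \<sigma> v})"
      and "v \<noteq> 0"
    then show "\<phi> (Inr (vec.span {v})) = Inr (vec.span {A *v map_vec \<sigma> v})"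
      using scalar_class_self by blast
  next
    fix B v
    assume "\<forall>v. v \<noteq> 0 \<longrightarrow> \<phi> (Inr (vec.span {v})) = Inr (vec.span {A *v map_vec \<sigma> v})"
      and "B \<in> scalar_class A" and "v \<noteq> (0 :: 'a^'n)"
    then show "\<phi> (Inr (vec.span {v})) = Inr (vec.span {B *v map_vec \<sigma> v})"
      by (simp add: span)
  qed
qed

text \<open>The action on the points \<open>\<langle>e\<^sub>i\<rangle>\<close> and \<open>\<langle>e\<^sub>i + e\<^sub>j\<rangle>\<close> determines the matrix up to a scalar,
  and then the action on the points \<open>\<langle>e\<^sub>i + x e\<^sub>j\<rangle>\<close> determines the field automorphism.\<close>

lemma semilinear_unique:
  fixes A B :: "'a::field^'n^'n"
  assumes n: "CARD('n) \<ge> 2" and A: "invertible A" and B: "invertible B"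
    and \<sigma>: "field_automorphism \<sigma>" and \<tau>: "field_automorphism \<tau>"
    and eq: "\<And>v. v \<noteq> 0 \<Longrightarrow> vec.span {A *v map_vec \<sigma> v} = vec.span {B *v map_vec \<tau> v}"
  shows "scalar_class A = scalar_class B \<and> \<sigma> = \<tau>"
proof -
  obtain B' where B': "B ** B' = mat 1" "B' ** B = mat 1" using B by (auto simp: invertible_def)
  define C where "C = B' ** A"
  note simps = field_automorphism_simps[OF \<sigma>] field_automorphism_simps[OF \<tau>]
  have C: "\<exists>c. C *v map_vec \<sigma> v = c *s map_vec \<tau> v" if v: "v \<noteq> 0" for v
  proof -
    have "A *v map_vec \<sigma> v \<in> vec.span {B *v map_vec \<tau> v}" using eq[OF v] vec.span_base by blast
    then obtain c where "A *v map_vec \<sigma> v = c *s (B *v map_vec \<tau> v)" by (auto simp: span_singleton_iff)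
    then have "C *v map_vec \<sigma> v = B' *v (c *s (B *v map_vec \<tau> v))" by (simp add: C_def matrix_vector_mul_assoc[symmetric])
    then show ?thesis by (auto simp: vec.scale matrix_vector_mul_assoc B')
  qed
  have map_ax: "map_vec \<sigma> (axis i 1) = axis i 1" "map_vec \<tau> (axis i 1) = axis i 1" for i
    by (auto simp: vec_eq_iff axis_nth_if simps)
  have "\<exists>c. C *v axis i 1 = c *s axis i 1" for i using C[of "axis i 1"] by (simp add: map_ax)
  then obtain d where d: "\<And>i. C *v axis i 1 = d i *s axis i 1" by metis
  have map2: "map_vec \<rho> (axis i 1 + x *s axis j 1) = axis i 1 + \<rho> x *s axis j 1" if "i \<noteq> j" and \<rho>: "field_automorphism \<rho>" for i j x and \<rho> :: "'a \<Rightarrow> 'a"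
    using that by (auto simp: vec_eq_iff axis_nth_if field_automorphism_simps[OF \<rho>])
  \<comment> \<open>The case \<open>x = 1\<close> shows that all \<open>d i\<close> are equal; then every \<open>x\<close> gives \<open>\<sigma> x = \<tau> x\<close>.\<close>
  have two: "d j * \<sigma> x = d i * \<tau> x" if ij: "i \<noteq> j" for i j x
  proof -
    let ?v = "axis i 1 + x *s axis j (1::'a)"
    have "?v $ i \<noteq> 0" using ij by (simp add: axis_nth_if)
    then have v: "?v \<noteq> 0" by (metis zero_index)
    then obtain c where c: "C *v (axis i 1 + \<sigma> x *s axis j 1) = c *s (axis i 1 + \<tau> x *s axis j 1)"
      using C[OF v] map2[OF ij \<sigma>] map2[OF ij \<tau>] by auto
    then have e: "d i *s axis i 1 + (\<sigma> x * d j) *s axis j 1 = c *s axis i 1 + (c * \<tau> x) *s axis j (1::'a)"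
      by (simp add: matrix_vector_right_distrib vec.scale d vec.scale_right_distrib)
    from arg_cong[OF e, of "\<lambda>y. y $ i"] arg_cong[OF e, of "\<lambda>y. y $ j"] ij show ?thesis
      by (simp add: axis_nth_if mult.commute)
  qed
  have dd: "d i = d j" for i j using two[of i j 1] by (cases "i = j") (auto simp: simps)
  fix k :: 'n
  have d': "C *v axis i 1 = d k *s axis i 1" for i using d dd[of i k] by simp
  have "C *v v = mat_scale (d k) (mat 1) *v v" for v
  proof -
    have "v = (\<Sum>i\<in>UNIV. v $ i *s axis i 1)" by (simp add: basis_expansion)
    then have "C *v v = (\<Sum>i\<in>UNIV. C *v (v $ i *s axis i 1))" by (metis vec.sum)
    also have "\<dots> = (\<Sum>i\<in>UNIV. d k *s (v $ i *s axis i 1))"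
      by (simp add: vec.scale d' mult.commute)
    also have "\<dots> = d k *s (\<Sum>i\<in>UNIV. v $ i *s axis i 1)" by (rule vec.scale_sum_right[symmetric])
    also have "\<dots> = d k *s v" by (simp only: basis_expansion)
    finally show ?thesis by (simp add: mat_scale_vector_mult)
  qed
  then have "C = mat_scale (d k) (mat 1)" by (simp add: matrix_eq)
  then have "B ** C = mat_scale (d k) B" by (simp add: mat_scale_mat_1 mat_mult_eq_scale(2))
  then have AB: "A = mat_scale (d k) B" by (simp add: C_def matrix_mul_assoc B')
  have dk: "d k \<noteq> 0"
  proof
    assume "d k = 0"
    then have "A *v axis k 1 = 0" by (simp add: AB mat_scale_vector_mult)
    with invertible_mult_vector_eq_0[OF A] show False by simp
  qed
  have "card (UNIV - {k}) \<ge> 1" using n by (simp add: card_Diff_singleton)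
  then have "UNIV - {k} \<noteq> {}" by (metis card.empty not_one_le_zero)
  then obtain l where "l \<noteq> k" by auto
  then have "\<sigma> x = \<tau> x" for x using two[of k l x] dd[of l k] dk by simp
  then show ?thesis using AB dk by (auto simp: scalar_class_scale)
qed

lemma restricts_to_unique:
  assumes n: "CARD('n::finite) \<ge> 2" and "g \<in> carrier PGammaL" "g' \<in> carrier PGammaL"
    and "restricts_to \<phi> g" "restricts_to (\<phi> :: ('a::field, 'n) sig_vertex \<Rightarrow> _) g'"
  shows "g = g'"
proof -
  obtain A \<sigma> where A: "g = (scalar_class A, \<sigma>)" "invertible A" "field_automorphism \<sigma>"
    using assms(2) by (rule PGammaL_cases)
  obtain B \<tau> where B: "g' = (scalar_class B, \<tau>)" "invertible B" "field_automorphism \<tau>"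
    using assms(3) by (rule PGammaL_cases)
  have "scalar_class A = scalar_class B \<and> \<sigma> = \<tau>"
    using assms(4,5) A B by (intro semilinear_unique[OF n]) (auto simp: restricts_to_iff)
  with A B show ?thesis by simp
qed

section \<open>Semilinear maps induce automorphisms\<close>

lemma group_aut_group: "group (aut_group G)"
proof -
  interpret B: group "BijGroup (pverts G)" by (rule group_BijGroup)
  let ?H = "{f \<in> Bij (pverts G). \<forall>x \<in> pverts G. \<forall>y \<in> pverts G. (f x, f y) \<in> parcs G \<longleftrightarrow> (x, y) \<in> parcs G}"
  have "subgroup ?H (BijGroup (pverts G))"
  proof (rule B.subgroupI)
    show "?H \<subseteq> carrier (BijGroup (pverts G))" by (auto simp: BijGroup_def)
    have "(\<lambda>x\<in>pverts G. x) \<in> ?H" by (auto simp: id_Bij)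
    then show "?H \<noteq> {}" by blast
  next
    fix f assume f: "f \<in> ?H"
    let ?g = "\<lambda>x\<in>pverts G. inv_into (pverts G) f x"
    have b: "bij_betw f (pverts G) (pverts G)" using f by (auto simp: Bij_def)
    have g: "?g x \<in> pverts G" "f (?g x) = x" if "x \<in> pverts G" for x
      using that b by (auto simp: bij_betw_def inv_into_into f_inv_into_f)
    have "(?g x, ?g y) \<in> parcs G \<longleftrightarrow> (x, y) \<in> parcs G" if xy: "x \<in> pverts G" "y \<in> pverts G" for x y
    proof -
      have "(f (?g x), f (?g y)) \<in> parcs G \<longleftrightarrow> (?g x, ?g y) \<in> parcs G" using f g xy by blast
      then show ?thesis by (simp only: g xy)
    qed
    then have "?g \<in> ?H" using f restrict_inv_into_Bij[of f] by blast
    moreover have "f \<in> Bij (pverts G)" using f by blast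
    ultimately show "inv\<^bsub>BijGroup (pverts G)\<^esub> f \<in> ?H" by (subst inv_BijGroup)
  next
    fix f g assume f: "f \<in> ?H" and g: "g \<in> ?H"
    have "g x \<in> pverts G" if "x \<in> pverts G" for x using g that by (auto simp: Bij_def dest: bij_betwE)
    then have "compose (pverts G) f g \<in> ?H" using f g compose_Bij by (auto simp: compose_eq)
    then show "f \<otimes>\<^bsub>BijGroup (pverts G)\<^esub> g \<in> ?H" using f g by (simp add: BijGroup_def)
  qed
  then show ?thesis unfolding aut_group_def by (rule B.subgroup_imp_group)
qed

lemma aut_group_mult:
  assumes "\<phi> \<in> carrier (aut_group G)" "\<psi> \<in> carrier (aut_group G)"
  shows "\<phi> \<otimes>\<^bsub>aut_group G\<^esub> \<psi> = compose (pverts G) \<phi> \<psi>"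
  using assms by (simp add: aut_group_def BijGroup_def)

lemma Bij_finiteI:
  assumes "finite S" and "f \<in> extensional S" and "inj_on f S" and "\<And>x. x \<in> S \<Longrightarrow> f x \<in> S"
  shows "f \<in> Bij S"
proof -
  have "f ` S = S" using assms by (intro endo_inj_surj) auto
  then show ?thesis using assms by (simp add: Bij_def bij_betw_def)
qed

lemma aut_SIG_I:
  fixes \<phi> :: "('a::{field,finite}, 'n::finite) sig_vertex \<Rightarrow> ('a, 'n) sig_vertex"
  assumes "\<phi> \<in> extensional (pverts SIG)" and "inj_on \<phi> (pverts SIG)"
    and m: "\<And>M. M \<in> eigen_matrices \<Longrightarrow> \<exists>m. \<phi> (Inl (mats.span {M})) = Inl m"
    and p: "\<And>v. v \<noteq> 0 \<Longrightarrow> \<exists>p. \<phi> (Inr (vec.span {v})) = Inr p"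
    and V: "\<And>x. x \<in> pverts SIG \<Longrightarrow> \<phi> x \<in> pverts SIG"
    and e: "\<And>M v. M \<in> eigen_matrices \<Longrightarrow> v \<noteq> 0 \<Longrightarrow>
      (\<phi> (Inl (mats.span {M})), \<phi> (Inr (vec.span {v}))) \<in> parcs SIG \<longleftrightarrow> eigenvector M v"
  shows "\<phi> \<in> carrier (aut_group SIG)"
proof -
  have "(\<phi> x, \<phi> y) \<in> parcs SIG \<longleftrightarrow> (x, y) \<in> parcs SIG" if x: "x \<in> pverts SIG" and y: "y \<in> pverts SIG" for x y
    using x
  proof (cases rule: SIG_vert_cases)
    case (matrix M)
    note M = this
    from y show ?thesis
    proof (cases rule: SIG_vert_cases)
      case (matrix N)
      then show ?thesis using M m[of M] m[of N] SIG_no_arc by metis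
    next
      case (point v)
      then show ?thesis using M e by (simp add: SIG_arc_iff)
    qed
  next
    case (point v)
    note v = this
    from y show ?thesis
    proof (cases rule: SIG_vert_cases)
      case (matrix N)
      then show ?thesis using v e SIG_arc_sym[of "\<phi> x" "\<phi> y"] by (simp add: SIG_arc_iff)
    next
      case (point w)
      then show ?thesis using v p[of v] p[of w] SIG_no_arc by metis
    qed
  qed
  moreover have "\<phi> \<in> Bij (pverts SIG)" by (rule Bij_finiteI) (use assms in auto)
  ultimately show ?thesis by (auto simp: aut_group_def)
qed

text \<open>With \<open>T v = A v\<^sup>\<sigma>\<close> and \<open>C M = A M\<^sup>\<sigma> A\<^sup>-\<^sup>1\<close> one has \<open>(C M) (T v) = T (M v)\<close>, so \<open>C\<close> and \<open>T\<close>
  together preserve eigenvectors.\<close>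

lemma semilinear_aut:
  fixes A :: "'a::{field,finite}^'n^'n::finite"
  assumes A: "invertible A" and \<sigma>: "field_automorphism \<sigma>"
  obtains \<phi> where "\<phi> \<in> carrier (aut_group SIG)" and "restricts_to \<phi> (scalar_class A, \<sigma>)"
proof -
  obtain A' where A': "A ** A' = mat 1" "A' ** A = mat 1" using A by (auto simp: invertible_def)
  note simps = field_automorphism_simps[OF \<sigma>]
  define T where "T v = A *v map_vec \<sigma> v" for v
  define C where "C M = A ** map_matrix \<sigma> M ** A'" for M
  have T0: "T v = 0 \<longleftrightarrow> v = 0" for v
    by (simp add: T_def invertible_mult_vector_eq_0[OF A] map_vec_eq_0_iff[OF \<sigma>])
  have Tscale: "T (c *s v) = \<sigma> c *s T v" for c v
    by (simp only: T_def map_vec_scale[OF \<sigma>] vec.scale)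
  have Cscale: "C (mat_scale c M) = mat_scale (\<sigma> c) (C M)" for c M
    by (simp only: C_def map_matrix_scale[OF \<sigma>] matrix_scale_left matrix_scale_right)
  have CT: "C M *v T v = T (M *v v)" for M v
  proof -
    have "C M *v T v = (A ** map_matrix \<sigma> M ** (A' ** A)) *v map_vec \<sigma> v"
      by (simp only: C_def T_def matrix_vector_mul_assoc matrix_mul_assoc)
    also have "\<dots> = T (M *v v)"
      by (simp add: A' T_def map_vec_matrix_vector_mult[OF \<sigma>] matrix_vector_mul_assoc)
    finally show ?thesis .
  qed
  have injT: "inj T"
  proof (rule injI)
    fix v w assume "T v = T w"
    then have "map_vec \<sigma> v = map_vec \<sigma> w"
      unfolding T_def using inj_matrix_vector_mult[OF A] by (simp add: inj_eq)
    then show "v = w" by (simp add: vec_eq_iff simps)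
  qed
  have injC: "inj C"
  proof (rule injI)
    fix M N assume "C M = C N"
    then have "T (M *v v) = T (N *v v)" for v by (simp only: CT[symmetric])
    then have "M *v v = N *v v" for v using injT by (simp add: inj_eq)
    then show "M = N" by (simp add: matrix_eq)
  qed
  have range\<sigma>: "range \<sigma> = UNIV" using \<sigma> by (simp add: field_automorphism_def bij_is_surj)
  then have surj: "\<exists>d. c = \<sigma> d" for c by auto
  have E: "eigenvector (C M) (T v) \<longleftrightarrow> eigenvector M v" for M v
  proof -
    have "(\<exists>c. T (M *v v) = c *s T v) \<longleftrightarrow> (\<exists>c. M *v v = c *s v)"
    proof
      assume "\<exists>c. T (M *v v) = c *s T v"
      then obtain c where "T (M *v v) = T (c *s v)" using surj Tscale by metis
      then show "\<exists>c. M *v v = c *s v" using injT by (auto simp: inj_eq)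
    qed (use Tscale in metis)
    then show ?thesis by (simp add: eigenvector_def CT T0)
  qed
  have Tspan: "T ` vec.span {v} = vec.span {T v}" for v
  proof -
    have "T ` range (\<lambda>k. k *s v) = (\<lambda>k. k *s T v) ` range \<sigma>" by (simp add: image_image Tscale)
    then show ?thesis by (simp only: vec.span_singleton range\<sigma>)
  qed
  have Cspan: "C ` mats.span {M} = mats.span {C M}" for M
  proof -
    have "C ` range (\<lambda>k. mat_scale k M) = (\<lambda>k. mat_scale k (C M)) ` range \<sigma>"
      by (simp add: image_image Cscale)
    then show ?thesis by (simp only: mats.span_singleton range\<sigma>)
  qed
  have C_eigen: "C M \<in> eigen_matrices" if "M \<in> eigen_matrices" for M
  proof -
    have "C 0 = 0" by (simp add: C_def vec_eq_iff matrix_matrix_mult_def simps)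
    then have "C M \<noteq> 0" using that injC by (metis (mono_tags, lifting) eigen_matrices_def injD mem_Collect_eq)
    then show ?thesis using that E by (auto simp: eigen_matrices_def)
  qed
  define \<phi> :: "('a, 'n) sig_vertex \<Rightarrow> ('a, 'n) sig_vertex"
    where "\<phi> = (\<lambda>x\<in>pverts SIG. map_sum ((`) C) ((`) T) x)"
  have \<phi>m: "\<phi> (Inl (mats.span {M})) = Inl (mats.span {C M})" if "M \<in> eigen_matrices" for M
    using SIG_verts_matrix[OF that] by (simp add: \<phi>_def Cspan)
  have \<phi>p: "\<phi> (Inr (vec.span {v})) = Inr (vec.span {T v})" if "v \<noteq> 0" for v
    using SIG_verts_point[OF that] by (simp add: \<phi>_def Tspan)
  have "\<phi> \<in> carrier (aut_group SIG)"
  proof (rule aut_SIG_I)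
    show "\<phi> \<in> extensional (pverts SIG)" by (simp add: \<phi>_def)
    have "inj ((`) C)" "inj ((`) T)"
      using inj_image_eq_iff[OF injC] inj_image_eq_iff[OF injT] by (simp_all add: inj_def)
    then have "inj (map_sum ((`) C) ((`) T))" by (rule sum.inj_map)
    then show "inj_on \<phi> (pverts SIG)"
      unfolding \<phi>_def inj_on_restrict_eq by (rule inj_on_subset) simp
    show "\<phi> x \<in> pverts SIG" if "x \<in> pverts SIG" for x
      using that by (cases rule: SIG_vert_cases) (auto simp: \<phi>m \<phi>p C_eigen T0 intro!: SIG_verts_matrix SIG_verts_point)
    show "(\<phi> (Inl (mats.span {M})), \<phi> (Inr (vec.span {v}))) \<in> parcs SIG \<longleftrightarrow> eigenvector M v"
      if "M \<in> eigen_matrices" "v \<noteq> 0" for M v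
      using that by (simp add: \<phi>m \<phi>p SIG_arc_iff C_eigen E)
  qed (auto simp: \<phi>m \<phi>p)
  moreover have "restricts_to \<phi> (scalar_class A, \<sigma>)" using \<phi>p by (simp add: restricts_to_iff T_def)
  ultimately show thesis by (rule that)
qed

section \<open>The restriction homomorphism\<close>

lemma ex1_restricts_to:
  fixes \<phi> :: "('a::{field,finite}, 'n::finite) sig_vertex \<Rightarrow> ('a, 'n) sig_vertex"
  assumes n: "CARD('n) \<ge> 3" and \<phi>: "\<phi> \<in> carrier (aut_group SIG)"
  shows "\<exists>!g. g \<in> carrier PGammaL \<and> restricts_to \<phi> g"
proof -
  have n2: "CARD('n) \<ge> 2" using n by simp
  obtain A \<sigma> where A: "invertible A" "field_automorphism \<sigma>"
    and \<phi>A: "\<And>v. v \<noteq> 0 \<Longrightarrow> \<phi> (Inr (vec.span {v})) = Inr (vec.span {A *v map_vec \<sigma> v})"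
    using aut_semilinear[OF n \<phi>] by blast
  have "(scalar_class A, \<sigma>) \<in> carrier PGammaL" using A by (auto simp: carrier_PGammaL)
  moreover have "restricts_to \<phi> (scalar_class A, \<sigma>)" using \<phi>A by (simp add: restricts_to_iff)
  ultimately show ?thesis using restricts_to_unique[OF n2] by blast
qed

lemma Phi_props:
  fixes \<phi> :: "('a::{field,finite}, 'n::finite) sig_vertex \<Rightarrow> ('a, 'n) sig_vertex"
  assumes n: "CARD('n) \<ge> 3" and \<phi>: "\<phi> \<in> carrier (aut_group SIG)"
  shows "Phi \<phi> \<in> carrier PGammaL" and "restricts_to \<phi> (Phi \<phi>)"
    and "g \<in> carrier PGammaL \<Longrightarrow> restricts_to \<phi> g \<Longrightarrow> Phi \<phi> = g"
proof -
  note ex1 = ex1_restricts_to[OF n \<phi>]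
  from theI'[OF ex1, folded Phi_def]
  show "Phi \<phi> \<in> carrier PGammaL" "restricts_to \<phi> (Phi \<phi>)" by (rule conjunct1, rule conjunct2)
  show "Phi \<phi> = g" if "g \<in> carrier PGammaL" "restricts_to \<phi> g"
    unfolding Phi_def using ex1 conjI[OF that] by (rule the1_equality)
qed

lemma restricts_to_mult:
  fixes \<phi> \<psi> :: "('a::{field,finite}, 'n::finite) sig_vertex \<Rightarrow> ('a, 'n) sig_vertex"
  assumes \<phi>: "\<phi> \<in> carrier (aut_group SIG)" and \<psi>: "\<psi> \<in> carrier (aut_group SIG)"
    and g: "g \<in> carrier PGammaL" and h: "h \<in> carrier PGammaL"
    and "restricts_to \<phi> g" and "restricts_to \<psi> h"
  shows "restricts_to (\<phi> \<otimes>\<^bsub>aut_group SIG\<^esub> \<psi>) (g \<otimes>\<^bsub>PGammaL\<^esub> h)"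
proof -
  obtain A \<sigma> where A: "g = (scalar_class A, \<sigma>)" "invertible A" "field_automorphism \<sigma>"
    using g by (rule PGammaL_cases)
  obtain B \<tau> where B: "h = (scalar_class B, \<tau>)" "invertible B" "field_automorphism \<tau>"
    using h by (rule PGammaL_cases)
  show ?thesis
    unfolding aut_group_mult[OF \<phi> \<psi>] A(1) B(1) mult_PGammaL[OF A(2) B(2) A(3)] restricts_to_iff
  proof (intro allI impI)
    fix v :: "'a^'n" assume v: "v \<noteq> 0"
    then have v': "B *v map_vec \<tau> v \<noteq> 0"
      using B by (simp add: invertible_mult_vector_eq_0 map_vec_eq_0_iff)
    have "compose (pverts SIG) \<phi> \<psi> (Inr (vec.span {v})) = \<phi> (\<psi> (Inr (vec.span {v})))"
      using SIG_verts_point[OF v] by (rule compose_eq)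
    also have "\<dots> = \<phi> (Inr (vec.span {B *v map_vec \<tau> v}))"
      using assms(6) v by (simp add: B restricts_to_iff)
    also have "\<dots> = Inr (vec.span {A *v map_vec \<sigma> (B *v map_vec \<tau> v)})"
      using assms(5) v' by (simp add: A restricts_to_iff)
    also have "A *v map_vec \<sigma> (B *v map_vec \<tau> v) = (A ** map_matrix \<sigma> B) *v map_vec (\<sigma> \<circ> \<tau>) v"
      by (simp add: map_vec_matrix_vector_mult[OF A(3)] matrix_vector_mul_assoc)
    finally show "compose (pverts SIG) \<phi> \<psi> (Inr (vec.span {v})) =
      Inr (vec.span {(A ** map_matrix \<sigma> B) *v map_vec (\<sigma> \<circ> \<tau>) v})" .
  qed
qed

lemma group_hom_Phi:
  assumes n: "CARD('n::finite) \<ge> 3"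
  shows "group_hom (aut_group (SIG :: ('a::{field,finite}, 'n) sig_vertex pair_pre_digraph)) PGammaL Phi"
proof -
  let ?G = "aut_group (SIG :: ('a, 'n) sig_vertex pair_pre_digraph)"
  interpret A: group ?G by (rule group_aut_group)
  interpret P: group "PGammaL :: (('a^'n^'n) set \<times> ('a \<Rightarrow> 'a)) monoid" by (rule group_PGammaL)
  have "Phi \<in> hom ?G PGammaL"
  proof (rule homI)
    show "Phi \<phi> \<in> carrier PGammaL" if "\<phi> \<in> carrier ?G" for \<phi> using Phi_props(1)[OF n that] .
    show "Phi (\<phi> \<otimes>\<^bsub>?G\<^esub> \<psi>) = Phi \<phi> \<otimes>\<^bsub>PGammaL\<^esub> Phi \<psi>" if "\<phi> \<in> carrier ?G" "\<psi> \<in> carrier ?G" for \<phi> \<psi>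
      using that by (intro Phi_props(3)[OF n] restricts_to_mult) (auto intro: Phi_props[OF n])
  qed
  then show ?thesis by (simp add: group_hom_def group_hom_axioms_def A.is_group P.is_group)
qed

lemma Phi_epi:
  assumes n: "CARD('n::finite) \<ge> 3"
  shows "Phi \<in> epi (aut_group (SIG :: ('a::{field,finite}, 'n) sig_vertex pair_pre_digraph)) PGammaL"
proof -
  let ?G = "aut_group (SIG :: ('a, 'n) sig_vertex pair_pre_digraph)"
  have "g \<in> Phi ` carrier ?G" if g: "g \<in> carrier PGammaL" for g
  proof -
    obtain A \<sigma> where A: "g = (scalar_class A, \<sigma>)" "invertible A" "field_automorphism \<sigma>"
      using g by (rule PGammaL_cases)
    obtain \<phi> where "\<phi> \<in> carrier ?G" "restricts_to \<phi> g" using semilinear_aut[OF A(2,3)] A(1) by blast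
    then show ?thesis using Phi_props(3)[OF n _ g] by blast
  qed
  moreover have "Phi \<in> hom ?G PGammaL" using group_hom.homh[OF group_hom_Phi[OF n]] .
  moreover have "Phi ` carrier ?G \<subseteq> carrier PGammaL" using Phi_props(1)[OF n] by blast
  ultimately show ?thesis unfolding epi_def by blast
qed

lemma kernel_Phi_iff:
  fixes \<phi> :: "('a::{field,finite}, 'n::finite) sig_vertex \<Rightarrow> ('a, 'n) sig_vertex"
  assumes n: "CARD('n) \<ge> 3"
  shows "\<phi> \<in> kernel (aut_group SIG) PGammaL Phi \<longleftrightarrow>
    \<phi> \<in> carrier (aut_group SIG) \<and> (\<forall>v. v \<noteq> 0 \<longrightarrow> \<phi> (Inr (vec.span {v})) = Inr (vec.span {v}))"
proof -
  have one: "\<one>\<^bsub>PGammaL\<^esub> \<in> carrier (PGammaL :: (('a^'n^'n) set \<times> ('a \<Rightarrow> 'a)) monoid)"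
    using group_PGammaL by (rule group.is_monoid[THEN monoid.one_closed])
  have "restricts_to \<phi> \<one>\<^bsub>PGammaL\<^esub> \<longleftrightarrow> (\<forall>v. v \<noteq> 0 \<longrightarrow> \<phi> (Inr (vec.span {v})) = Inr (vec.span {v}))"
    by (simp add: one_PGammaL restricts_to_iff)
  moreover have "Phi \<phi> = \<one>\<^bsub>PGammaL\<^esub> \<longleftrightarrow> restricts_to \<phi> \<one>\<^bsub>PGammaL\<^esub>" if \<phi>: "\<phi> \<in> carrier (aut_group SIG)"
  proof
    assume "Phi \<phi> = \<one>\<^bsub>PGammaL\<^esub>"
    then show "restricts_to \<phi> \<one>\<^bsub>PGammaL\<^esub>" using Phi_props(2)[OF n \<phi>] by (simp only:)
  qed (rule Phi_props(3)[OF n \<phi> one])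
  ultimately show ?thesis unfolding kernel_def by blast
qed

section \<open>The kernel and the twin classes\<close>

lemma equiv_twin_rel: "equiv (pverts G) (twin_rel G)"
  by (auto simp: equiv_def refl_on_def sym_def trans_def twin_rel_def)

lemma twin_rel_iff: "(x, y) \<in> twin_rel G \<longleftrightarrow> x \<in> pverts G \<and> y \<in> pverts G \<and> neighbours G x = neighbours G y"
  by (simp add: twin_rel_def)

text \<open>Every matrix vertex has a neighbour, which is a point and hence not adjacent to a point.\<close>

lemma twin_of_matrix:
  assumes M: "M \<in> eigen_matrices" and tw: "(Inl (mats.span {M}), y) \<in> twin_rel SIG"
  obtains N where "N \<in> eigen_matrices" and "y = Inl (mats.span {N})"
proof -
  have y: "y \<in> pverts SIG" and nb: "neighbours SIG (Inl (mats.span {M})) = neighbours SIG y"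
    using tw by (auto simp: twin_rel_iff)
  obtain v where "eigenvector M v" using M by (auto simp: eigen_matrices_def)
  then have "Inr (vec.span {v}) \<in> neighbours SIG y"
    unfolding nb[symmetric] by (simp add: neighbours_def SIG_arc_iff M)
  with y that show thesis
    by (cases rule: SIG_vert_cases) (auto simp: neighbours_def SIG_no_arc)
qed

lemma matrix_twin_class_eq:
  assumes C: "C \<in> matrix_twin_classes" and x: "x \<in> C"
  shows "C = twin_rel SIG `` {x}"
proof -
  obtain y where "C = twin_rel SIG `` {y}"
    using C by (auto simp: matrix_twin_classes_def twin_classes_def elim: quotientE)
  with x show ?thesis using equiv_class_eq[OF equiv_twin_rel, of y x] by auto
qed

lemma matrix_twin_class_memE:
  assumes C: "C \<in> matrix_twin_classes" and x: "x \<in> C"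
  obtains M where "M \<in> eigen_matrices" and "x = Inl (mats.span {M})"
proof -
  have "x \<in> Inl ` matrix_points" using C x by (auto simp: matrix_twin_classes_def)
  then show thesis using that by (auto simp: matrix_points_def)
qed

lemma matrix_twin_class_of:
  assumes M: "M \<in> eigen_matrices"
  shows "twin_rel SIG `` {Inl (mats.span {M})} \<in> matrix_twin_classes"
    and "Inl (mats.span {M}) \<in> twin_rel SIG `` {Inl (mats.span {M})}"
proof -
  let ?x = "Inl (mats.span {M})"
  have x: "?x \<in> pverts SIG" by (rule SIG_verts_matrix[OF M])
  then show "?x \<in> twin_rel SIG `` {?x}" by (simp add: twin_rel_iff)
  have "twin_rel SIG `` {?x} \<subseteq> Inl ` matrix_points"
  proof
    fix y assume "y \<in> twin_rel SIG `` {?x}"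
    then have "(?x, y) \<in> twin_rel SIG" by simp
    then obtain N where "N \<in> eigen_matrices" "y = Inl (mats.span {N})" by (rule twin_of_matrix[OF M])
    then show "y \<in> Inl ` matrix_points" by (auto simp: matrix_points_def)
  qed
  then show "twin_rel SIG `` {?x} \<in> matrix_twin_classes"
    using x by (simp add: matrix_twin_classes_def twin_classes_def quotientI)
qed

lemma matrix_twin_class_subset: "C \<in> matrix_twin_classes \<Longrightarrow> C \<subseteq> pverts SIG"
  using matrix_twin_class_memE SIG_verts_matrix by (metis subsetI)

lemma twin_action_matrix:
  assumes C: "C \<in> matrix_twin_classes" and x: "x \<in> C"
  shows "twin_action f x = f C x"
proof -
  obtain M where M: "M \<in> eigen_matrices" "x = Inl (mats.span {M})" using C x by (rule matrix_twin_class_memE)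
  then have "twin_action f x = f (twin_rel SIG `` {x}) x"
    using SIG_verts_matrix[OF M(1)] by (simp add: twin_action_def)
  then show ?thesis using matrix_twin_class_eq[OF C x] by simp
qed

lemma twin_action_point: "v \<noteq> 0 \<Longrightarrow> twin_action f (Inr (vec.span {v})) = Inr (vec.span {v})"
  using SIG_verts_point[of v] by (simp add: twin_action_def)

lemma SIG_twin_vert_cases:
  assumes "x \<in> pverts SIG"
  obtains (matrix) C where "C \<in> matrix_twin_classes" "x \<in> C"
    | (point) v where "v \<noteq> 0" "x = Inr (vec.span {v})"
  using assms by (cases rule: SIG_vert_cases) (use matrix_twin_class_of in blast)+

lemma Bij_mem: "f \<in> Bij S \<Longrightarrow> x \<in> S \<Longrightarrow> f x \<in> S"
  using Bij_imp_funcset by blast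

lemma twin_action_in_kernel:
  fixes f :: "('a::{field,finite}, 'n::finite) sig_vertex set \<Rightarrow> ('a, 'n) sig_vertex \<Rightarrow> ('a, 'n) sig_vertex"
  assumes n: "CARD('n) \<ge> 3" and f: "\<And>C. C \<in> matrix_twin_classes \<Longrightarrow> f C \<in> Bij C"
  shows "twin_action f \<in> kernel (aut_group SIG) PGammaL Phi"
proof -
  let ?\<phi> = "twin_action f"
  have mem: "?\<phi> x \<in> C" if "C \<in> matrix_twin_classes" "x \<in> C" for C x
    using twin_action_matrix[OF that] Bij_mem[OF f[OF that(1)] that(2)] by simp
  have "?\<phi> \<in> carrier (aut_group SIG)"
  proof (rule aut_SIG_I)
    show "?\<phi> \<in> extensional (pverts SIG)" by (simp add: twin_action_def)
    show "inj_on ?\<phi> (pverts SIG)"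
    proof (rule inj_onI)
      fix x y :: "('a, 'n) sig_vertex"
      assume x: "x \<in> pverts SIG" and y: "y \<in> pverts SIG" and eq: "?\<phi> x = ?\<phi> y"
      have no: "?\<phi> z \<noteq> Inr (vec.span {v})" if z: "z \<in> C" "C \<in> matrix_twin_classes" for z v C
        using matrix_twin_class_memE[OF z(2) mem[OF z(2,1)]] by (metis Inl_Inr_False)
      from x show "x = y"
      proof (cases rule: SIG_twin_vert_cases)
        case (matrix C)
        note C = this
        from y show ?thesis
        proof (cases rule: SIG_twin_vert_cases)
          case (matrix D)
          have "C = twin_rel SIG `` {?\<phi> x}" by (rule matrix_twin_class_eq) (use C mem in auto)
          moreover have "D = twin_rel SIG `` {?\<phi> x}" unfolding eq by (rule matrix_twin_class_eq) (use matrix mem in auto)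
          ultimately have "D = C" by simp
          then have "f C x = f C y" using eq C matrix by (simp add: twin_action_matrix)
          moreover have "inj_on (f C) C" using f[OF C(1)] by (simp add: Bij_def bij_betw_def)
          ultimately show ?thesis using C matrix \<open>D = C\<close> by (auto dest: inj_onD)
        next
          case (point v)
          then show ?thesis using no[OF C(2,1), of v] eq by (simp add: twin_action_point)
        qed
      next
        case (point v)
        note v = this
        from y show ?thesis
        proof (cases rule: SIG_twin_vert_cases)
          case (matrix D)
          then show ?thesis using no[OF matrix(2,1), of v] eq v by (simp add: twin_action_point)
        next
          case (point w)
          then show ?thesis using eq v by (simp add: twin_action_point)
        qed
      qed
    qed
    show "?\<phi> x \<in> pverts SIG" if "x \<in> pverts SIG" for x
      using that
    proof (cases rule: SIG_twin_vert_cases)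
      case (matrix C)
      then show ?thesis using mem matrix_twin_class_subset by blast
    next
      case (point v)
      then show ?thesis using that by (simp add: twin_action_point)
    qed
    fix M :: "'a^'n^'n" assume M: "M \<in> eigen_matrices"
    let ?x = "Inl (mats.span {M})"
    have tw: "(?x, ?\<phi> ?x) \<in> twin_rel SIG" using mem[OF matrix_twin_class_of[OF M]] by simp
    show "\<exists>m. ?\<phi> ?x = Inl m" using twin_of_matrix[OF M tw] by metis
    fix v :: "'a^'n" assume v: "v \<noteq> 0"
    have "Inr (vec.span {v}) \<in> neighbours SIG (?\<phi> ?x) \<longleftrightarrow> Inr (vec.span {v}) \<in> neighbours SIG ?x"
      using tw by (simp add: twin_rel_iff)
    then show "(?\<phi> ?x, ?\<phi> (Inr (vec.span {v}))) \<in> parcs SIG \<longleftrightarrow> eigenvector M v"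
      by (simp add: twin_action_point[OF v] neighbours_def SIG_arc_iff M)
  qed (simp add: twin_action_point)
  then show ?thesis by (simp add: kernel_Phi_iff[OF n] twin_action_point)
qed

text \<open>An automorphism that fixes all points fixes the neighbourhoods of the matrix vertices.\<close>

lemma kernel_preserves_twin_class:
  fixes \<phi> :: "('a::{field,finite}, 'n::finite) sig_vertex \<Rightarrow> ('a, 'n) sig_vertex"
  assumes n: "CARD('n) \<ge> 3" and \<phi>: "\<phi> \<in> kernel (aut_group SIG) PGammaL Phi"
    and C: "C \<in> matrix_twin_classes" and x: "x \<in> C"
  shows "\<phi> x \<in> C"
proof -
  have aut: "\<phi> \<in> carrier (aut_group SIG)" and fixed: "\<And>v. v \<noteq> 0 \<Longrightarrow> \<phi> (Inr (vec.span {v})) = Inr (vec.span {v})"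
    using \<phi> by (auto simp: kernel_Phi_iff[OF n])
  have n2: "CARD('n) \<ge> 2" using n by simp
  obtain M where M: "M \<in> eigen_matrices" "x = Inl (mats.span {M})" using C x by (rule matrix_twin_class_memE)
  obtain N where N: "N \<in> eigen_matrices" "\<phi> x = Inl (mats.span {N})"
    using aut_matrix_to_matrix[OF n2 aut M(1)] M(2) by metis
  have xV: "x \<in> pverts SIG" and \<phi>xV: "\<phi> x \<in> pverts SIG" using M N SIG_verts_matrix by auto
  have nbP: "\<exists>v. v \<noteq> 0 \<and> y = Inr (vec.span {v})" if y: "y \<in> neighbours SIG (Inl m)" for y m
  proof -
    have "y \<in> pverts SIG" using y by (auto simp: neighbours_def SIG_def sig_edges_def proj_points_def eigenvector_def)
    then show ?thesis using y by (cases rule: SIG_vert_cases) (auto simp: neighbours_def SIG_no_arc)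
  qed
  have iff: "Inr (vec.span {v}) \<in> neighbours SIG x \<longleftrightarrow> Inr (vec.span {v}) \<in> neighbours SIG (\<phi> x)" if v: "v \<noteq> 0" for v
    using aut_groupD(3)[OF aut xV SIG_verts_point[OF v]] fixed[OF v] by (simp add: neighbours_def)
  have "neighbours SIG x = neighbours SIG (\<phi> x)"
  proof (rule Set.set_eqI)
    fix y
    show "y \<in> neighbours SIG x \<longleftrightarrow> y \<in> neighbours SIG (\<phi> x)"
      using nbP[of y] iff M(2) N(2) by metis
  qed
  then have "(x, \<phi> x) \<in> twin_rel SIG" using xV \<phi>xV by (simp add: twin_rel_iff)
  then show ?thesis using matrix_twin_class_eq[OF C x] by blast
qed

lemma twin_action_iso:
  assumes n: "CARD('n::finite) \<ge> 3"
  shows "twin_action \<in> iso (product_group (matrix_twin_classes :: ('a::{field,finite}, 'n) sig_vertex set set) BijGroup)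
    ((aut_group SIG)\<lparr>carrier := kernel (aut_group SIG) PGammaL Phi\<rparr>)"
proof -
  let ?T = "matrix_twin_classes :: ('a, 'n) sig_vertex set set"
  let ?P = "product_group ?T BijGroup"
  let ?K = "kernel (aut_group (SIG :: ('a, 'n) sig_vertex pair_pre_digraph)) PGammaL Phi"
  have carP: "carrier ?P = (\<Pi>\<^sub>E C\<in>?T. Bij C)" by (simp add: BijGroup_def)
  have B: "f C \<in> Bij C" if "f \<in> carrier ?P" "C \<in> ?T" for f C
    using that unfolding carP by (rule PiE_mem)
  have K: "twin_action f \<in> ?K" if "f \<in> carrier ?P" for f
    using that by (intro twin_action_in_kernel[OF n] B)
  have aut: "\<phi> \<in> carrier (aut_group SIG)" if "\<phi> \<in> ?K" for \<phi>
    using that by (simp add: kernel_def)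
  have mult: "twin_action (f \<otimes>\<^bsub>?P\<^esub> g) = twin_action f \<otimes>\<^bsub>aut_group SIG\<^esub> twin_action g"
    if f: "f \<in> carrier ?P" and g: "g \<in> carrier ?P" for f g
  proof -
    have "twin_action (f \<otimes>\<^bsub>?P\<^esub> g) = compose (pverts SIG) (twin_action f) (twin_action g)"
    proof (rule extensionalityI[of _ "pverts SIG"])
      fix x :: "('a, 'n) sig_vertex" assume x: "x \<in> pverts SIG"
      then show "twin_action (f \<otimes>\<^bsub>?P\<^esub> g) x = compose (pverts SIG) (twin_action f) (twin_action g) x"
      proof (cases rule: SIG_twin_vert_cases)
        case (matrix C)
        have gx: "g C x \<in> C" using Bij_mem[OF B[OF g matrix(1)] matrix(2)] .
        have "(f \<otimes>\<^bsub>?P\<^esub> g) C = compose C (f C) (g C)"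
          using matrix(1) B[OF f matrix(1)] B[OF g matrix(1)] by (simp add: BijGroup_def)
        then show ?thesis
          using x matrix gx by (simp add: compose_eq twin_action_matrix[OF matrix(1)] del: mult_product_group)
      next
        case (point v)
        then show ?thesis using x by (simp add: compose_eq twin_action_point)
      qed
    qed (simp_all add: twin_action_def)
    then show ?thesis by (simp only: aut_group_mult[OF aut[OF K[OF f]] aut[OF K[OF g]]])
  qed
  have "inj_on twin_action (carrier ?P)"
  proof (rule inj_onI)
    fix f g assume f: "f \<in> carrier ?P" and g: "g \<in> carrier ?P" and eq: "twin_action f = twin_action g"
    have "f C = g C" if C: "C \<in> ?T" for C
    proof (rule extensionalityI[of _ C])
      show "f C \<in> extensional C" "g C \<in> extensional C"
        using B[OF f C] B[OF g C] by (auto dest: Bij_imp_extensional)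
      show "f C x = g C x" if "x \<in> C" for x
        using twin_action_matrix[OF C that, of f] twin_action_matrix[OF C that, of g] eq by simp
    qed
    then show "f = g" using f g unfolding carP by (rule PiE_ext[rotated 2])
  qed
  moreover have "twin_action ` carrier ?P = ?K"
  proof
    show "twin_action ` carrier ?P \<subseteq> ?K" using K by blast
    show "?K \<subseteq> twin_action ` carrier ?P"
    proof
      fix \<phi> assume \<phi>: "\<phi> \<in> ?K"
      define f where "f = (\<lambda>C\<in>?T. restrict \<phi> C)"
      have fixed: "\<phi> (Inr (vec.span {v})) = Inr (vec.span {v})" if "v \<noteq> 0" for v
        using \<phi> that by (simp add: kernel_Phi_iff[OF n])
      have inj: "inj_on \<phi> (pverts SIG)" using aut_groupD(1)[OF aut[OF \<phi>]] by (simp add: bij_betw_def)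
      have "restrict \<phi> C \<in> Bij C" if C: "C \<in> ?T" for C
      proof (rule Bij_finiteI)
        show "inj_on (restrict \<phi> C) C"
          using inj_on_subset[OF inj matrix_twin_class_subset[OF C]] by (simp add: inj_on_restrict_eq)
        show "restrict \<phi> C x \<in> C" if "x \<in> C" for x
          using kernel_preserves_twin_class[OF n \<phi> C that] that by simp
      qed simp_all
      then have f: "f \<in> carrier ?P" unfolding carP f_def by simp
      have "twin_action f = \<phi>"
      proof (rule extensionalityI[of _ "pverts SIG"])
        show "twin_action f \<in> extensional (pverts SIG)" by (simp add: twin_action_def)
        show "\<phi> \<in> extensional (pverts SIG)" by (rule aut_groupD(2)[OF aut[OF \<phi>]])
        fix x :: "('a, 'n) sig_vertex" assume "x \<in> pverts SIG"
        then show "twin_action f x = \<phi> x"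
        proof (cases rule: SIG_twin_vert_cases)
          case (matrix C)
          then show ?thesis by (simp add: twin_action_matrix[OF matrix] f_def)
        next
          case (point v)
          then show ?thesis by (simp add: twin_action_point fixed)
        qed
      qed
      with f show "\<phi> \<in> twin_action ` carrier ?P" by blast
    qed
  qed
  ultimately have "bij_betw twin_action (carrier ?P) ?K" by (simp only: bij_betw_def)
  moreover have "twin_action \<in> hom ?P ((aut_group SIG)\<lparr>carrier := ?K\<rparr>)"
    by (rule homI) (use K mult in \<open>simp_all del: carrier_product_group mult_product_group\<close>)
  ultimately show ?thesis by (simp add: iso_def del: carrier_product_group)
qed

theorem theorem3p14:
  fixes G :: "('a::{field,finite}, 'n::finite) sig_vertex pair_pre_digraph"
  assumes "CARD('n) \<ge> 3" and "G = SIG"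
  shows "(\<forall>\<phi> \<in> carrier (aut_group G). \<exists>!g. g \<in> carrier PGammaL \<and> restricts_to \<phi> g) \<and>
    group_hom (aut_group G) PGammaL Phi \<and>
    Phi \<in> epi (aut_group G) PGammaL \<and>
    twin_action \<in> iso (product_group matrix_twin_classes BijGroup)
      ((aut_group G)\<lparr>carrier := kernel (aut_group G) PGammaL Phi\<rparr>)"
  unfolding \<open>G = SIG\<close>
  using ex1_restricts_to[OF assms(1)] group_hom_Phi[OF assms(1)] Phi_epi[OF assms(1)] twin_action_iso[OF assms(1)]
  by blast

end
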